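(* Let $F$ be a free group and let $u_1, u_2 \in F$ be elements which do not belong to conjugate cyclic subgroups of $F$. Then for each prime number $p$ and each integer $n$ there exists a homomorphism $\varphi$ of $F$ onto a finite $p$-group such that $\varphi(u_1) \neq 1$, $\varphi(u_2) \neq 1$, and $$\frac{|\varphi(u_1)|}{|\varphi(u_2)|} = p^n .$$
   Context: For an element $g$ of a finite group, $|g|$ denotes the order of $g$. Elements $u_1, u_2$ "do not belong to conjugate cyclic subgroups" of $F$ means that there are no cyclic subgroups $C_1, C_2$ of $F$ that are conjugate in $F$ and satisfy $u_1 \in C_1$ and $u_2 \in C_2$. *)

theory Defs
  imports "HOL-Algebra.Multiplicative_Group" "HOL-Algebra.Generated_Groups" "HOL-Computational_Algebra.Primes"
begin

(* A letter (x, True) stands for x and (x, False) for the inverse of x. *)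
type_synonym 'a gword = "('a \<times> bool) list"

fun letter_value :: "('a, 'b) monoid_scheme \<Rightarrow> 'a \<times> bool \<Rightarrow> 'a" where
  "letter_value G (x, b) = (if b then x else inv\<^bsub>G\<^esub> x)"

definition word_value :: "('a, 'b) monoid_scheme \<Rightarrow> 'a gword \<Rightarrow> 'a" where
  "word_value G w = foldr (\<lambda>l y. letter_value G l \<otimes>\<^bsub>G\<^esub> y) w \<one>\<^bsub>G\<^esub>"

definition reduced_words :: "'a set \<Rightarrow> 'a gword set" where
  "reduced_words S =
     {w. set w \<subseteq> S \<times> UNIV \<and> successively (\<lambda>(x, a) (y, b). \<not> (x = y \<and> a \<noteq> b)) w}"

(* S is a free basis of G: every element of G is the value of exactly one reduced word
   in the letters from S and their inverses. *)
definition free_basis :: "('a, 'b) monoid_scheme \<Rightarrow> 'a set \<Rightarrow> bool" where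
  "free_basis G S \<longleftrightarrow>
     S \<subseteq> carrier G \<and> bij_betw (word_value G) (reduced_words S) (carrier G)"

(* The rank is arbitrary: S may be empty or infinite. *)
definition free_group :: "('a, 'b) monoid_scheme \<Rightarrow> bool" where
  "free_group G \<longleftrightarrow> group G \<and> (\<exists>S. free_basis G S)"

definition cyclic_subgroup :: "'a set \<Rightarrow> ('a, 'b) monoid_scheme \<Rightarrow> bool" where
  "cyclic_subgroup C G \<longleftrightarrow> (\<exists>c \<in> carrier G. C = generate G {c})"

definition conjugate_subgroups :: "('a, 'b) monoid_scheme \<Rightarrow> 'a set \<Rightarrow> 'a set \<Rightarrow> bool" where
  "conjugate_subgroups G C D \<longleftrightarrow>
     subgroup C G \<and> subgroup D G \<and> (\<exists>g \<in> carrier G. D = g <#\<^bsub>G\<^esub> (C #>\<^bsub>G\<^esub> inv\<^bsub>G\<^esub> g))"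

definition in_conjugate_cyclic_subgroups :: "('a, 'b) monoid_scheme \<Rightarrow> 'a \<Rightarrow> 'a \<Rightarrow> bool" where
  "in_conjugate_cyclic_subgroups G u v \<longleftrightarrow>
     (\<exists>C D. cyclic_subgroup C G \<and> cyclic_subgroup D G \<and> conjugate_subgroups G C D
            \<and> u \<in> C \<and> v \<in> D)"

(* The trivial group counts as a p-group. *)
definition finite_p_group :: "nat \<Rightarrow> ('a, 'b) monoid_scheme \<Rightarrow> bool" where
  "finite_p_group p G \<longleftrightarrow> group G \<and> finite (carrier G) \<and> (\<exists>k. order G = p ^ k)"

end

theory Submission
  imports Defs "HOL-Algebra.Sylow" "HOL-Algebra.Weak_Morphisms"
begin

text \<open>
  Proof idea. Finite \<open>p\<close>-quotients of the free group \<open>F\<close> are produced as follows. Let \<open>N\<close> be a normal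
  subgroup with \<open>F/N\<close> a finite \<open>p\<close>-group and let \<open>f\<close> be an integer weight on the edges of the Cayley graph
  of \<open>F/N\<close>. The elements of \<open>N\<close> along whose paths, from every starting vertex, the total weight is divisible
  by \<open>p ^ k\<close> form another such subgroup.

  Up to conjugation \<open>u1\<close> and \<open>u2\<close> are powers of cyclically reduced words \<open>w1\<close> and \<open>w2\<close> that are not
  proper powers. For small \<open>N\<close> the loop of \<open>w1\<close> at \<open>1\<close> and all loops of \<open>w2\<close> are simple, and no loop of \<open>w2\<close>
  is contained in that of \<open>w1\<close>, since otherwise a power of \<open>w2\<close> would be conjugate to a power of \<open>w1\<close>. So there are
  weights \<open>f\<close> whose sum along the loop of \<open>w1\<close> is \<open>0\<close> and along every loop of \<open>w2\<close> is nonzero. Let \<open>q\<close> be a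
  power of \<open>p\<close> dividing none of the latter sums, and let \<open>N'\<close> be given by \<open>f\<close> modulo \<open>q\<close>. On the graph of
  \<open>F/N'\<close> take the weight which is supported on the lifts of the first edge of \<open>w1\<close> and whose dependence on the
  accumulated \<open>f\<close>-weight has zero sum over every coset of every nontrivial subgroup of \<open>\<int>/q\<close>. It sums to zero
  along the loops of a fixed power of \<open>w2\<close> but not along those of \<open>w1\<close>. Hence the order of \<open>u1\<close> can be made
  arbitrarily large with that of \<open>u2\<close> bounded, and conversely. A chain of normal subgroups, along which either
  order changes by a factor \<open>1\<close> or \<open>p\<close> at each step, yields every ratio \<open>p ^ n\<close> in between.
\<close>

section \<open>Words and periodic sums\<close>

abbreviation letter_inv :: "'a \<times> bool \<Rightarrow> 'a \<times> bool" where
  "letter_inv l \<equiv> (fst l, \<not> snd l)"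

abbreviation word_inv :: "'a gword \<Rightarrow> 'a gword" where
  "word_inv w \<equiv> rev (map letter_inv w)"

abbreviation word_pow :: "'b list \<Rightarrow> nat \<Rightarrow> 'b list" where
  "word_pow w n \<equiv> concat (replicate n w)"

definition primitive_word :: "'b list \<Rightarrow> bool" where
  "primitive_word w \<longleftrightarrow> w \<noteq> [] \<and> (\<forall>t i. w = word_pow t i \<longrightarrow> i = 1)"

lemma word_pow_add: "word_pow w (m + n) = word_pow w m @ word_pow w n"
  by (simp add: replicate_add)

lemma word_pow_Suc2: "word_pow w (Suc n) = word_pow w n @ w"
  using word_pow_add[of n 1 w] by simp

lemma length_word_pow: "length (word_pow w n) = n * length w"
  by (induction n) auto

lemma set_word_pow: "set (word_pow w n) \<subseteq> set w"
  by auto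

text \<open>Commuting words are powers of a common word \<open>t\<close>, and primitivity leaves a
  single factor \<open>t\<close> to be shared between \<open>r\<close> and \<open>s\<close>.\<close>

lemma primitive_word_no_commuting_split:
  assumes "primitive_word (r @ s)" and "r @ s = s @ r"
  shows "r = [] \<or> s = []"
proof -
  obtain m n t where t: "word_pow t m = r" "word_pow t n = s"
    using comm_append_are_replicate[OF assms(2)] by blast
  then have "r @ s = word_pow t (m + n)"
    by (simp add: word_pow_add)
  then have "m + n = 1"
    using assms(1) unfolding primitive_word_def by blast
  then show ?thesis
    using t by (cases m) auto
qed

text \<open>The initial segments of both sides are compared. If \<open>z\<close> is at least as long
  as \<open>w\<close>, a copy of \<open>w\<close> is cancelled from its front and induction applies;
  a shorter \<open>z\<close> is a proper prefix of \<open>w\<close> and has to be empty.\<close>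

lemma commutes_with_primitive_power:
  assumes "primitive_word w" and "d \<ge> 1" and "z @ word_pow w d = word_pow w d @ z"
  shows "\<exists>q. z = word_pow w q"
  using assms(3)
proof (induction "length z" arbitrary: z rule: less_induct)
  case less
  obtain e where d: "d = Suc e"
    using assms(2) by (cases d) auto
  have eq: "z @ w @ word_pow w e = w @ word_pow w e @ z"
    using less.prems d by simp
  show ?case
  proof (cases "length z < length w")
    case True
    define s where "s = drop (length z) w"
    have "take (length z) w = z"
      using arg_cong[OF eq, of "take (length z)"] True by simp
    then have w: "w = z @ s"
      unfolding s_def by (metis append_take_drop_id)
    have eq': "z @ s @ word_pow w e = s @ word_pow w e @ z"
      using eq by (simp add: w)
    \<comment> \<open>This word starts with \<open>z\<close> whether \<open>e\<close> is 0 or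
      positive, since \<open>w\<close> starts with \<open>z\<close>. Cutting both sides of
      \<open>eq'\<close> at \<open>length w\<close> then shows that \<open>z\<close> and
      \<open>s\<close> commute.\<close>
    have "\<exists>v. word_pow w e @ z = z @ v"
      by (cases e) (auto simp: w)
    then obtain v where "word_pow w e @ z = z @ v"
      by blast
    then have "z @ s @ word_pow w e = s @ z @ v"
      using eq' by simp
    then have "(z @ s) @ word_pow w e = (s @ z) @ v"
      by simp
    then have "z @ s = s @ z"
      by (subst (asm) append_eq_append_conv) auto
    then have "z = [] \<or> s = []"
      using assms(1) primitive_word_no_commuting_split w by blast
    then have "z = []"
      using True w by auto
    then show ?thesis
      by (intro exI[of _ 0]) simp
  next
    case False
    define z' where "z' = drop (length w) z"
    have "take (length w) z = w"
      using arg_cong[OF eq, of "take (length w)"] False by simp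
    then have z: "z = w @ z'"
      unfolding z'_def by (metis append_take_drop_id)
    have "word_pow w d @ w = w @ word_pow w d"
      using word_pow_Suc2[of d w] by simp
    then have "w @ (z' @ word_pow w d) = w @ (word_pow w d @ z')"
      using less.prems unfolding z by (metis append.assoc)
    then have "z' @ word_pow w d = word_pow w d @ z'"
      by simp
    moreover have "length z' < length z"
      using assms(1) z by (simp add: primitive_word_def)
    ultimately obtain q where "z' = word_pow w q"
      using less.hyps by blast
    then show ?thesis
      using z by (intro exI[of _ "Suc q"]) simp
  qed
qed

lemma take_word_pow:
  assumes "i < n * length w"
  shows "take i (word_pow w n) = word_pow w (i div length w) @ take (i mod length w) w"
proof -
  define q where "q = i div length w"
  have len: "length w > 0"
    using assms by (cases w) auto
  have "q < n"
    unfolding q_def using assms len by (simp add: less_mult_imp_div_less)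
  then have "word_pow w n = word_pow w q @ w @ word_pow w (n - Suc q)"
    using word_pow_add[of q "n - q" w] word_pow_add[of 1 "n - Suc q" w] by (simp add: Suc_diff_Suc)
  moreover have "i - length (word_pow w q) = i mod length w" "take i (word_pow w q) = word_pow w q"
    unfolding length_word_pow q_def
    by (simp_all only: minus_div_mult_eq_mod take_all_iff length_word_pow div_times_less_eq_dividend)
  moreover have "i mod length w - length w = 0"
    using len by (simp add: less_imp_le)
  ultimately show ?thesis
    unfolding q_def[symmetric] by (simp only: take_append take_0 append_Nil2)
qed

section \<open>Counting residues modulo a prime power\<close>

lemma periodic_sum_shift:
  fixes F :: "nat \<Rightarrow> int"
  assumes "\<And>i. F (i + q) = F i"
  shows "(\<Sum>i<q. F (i + k)) = (\<Sum>i<q. F i)"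
proof (induction k)
  case (Suc k)
  have "(\<Sum>i<q. F (i + k)) + F (q + k) = F k + (\<Sum>i<q. F (Suc i + k))"
    using sum.lessThan_Suc_shift[of "\<lambda>i. F (i + k)" q] by simp
  moreover have "F (q + k) = F k"
    using assms[of k] by (simp add: add.commute)
  ultimately show ?case
    using Suc by simp
qed simp

text \<open>With \<open>q = p ^ Suc m\<close>, the values \<open>int i * C + t\<close> run evenly
  through a coset of the subgroup generated by \<open>C\<close> in the integers modulo
  \<open>q\<close>. This subgroup is nontrivial, hence contains \<open>p ^ m\<close>, so translation
  by \<open>p ^ m\<close> permutes the coset.\<close>

lemma sum_residue_shift:
  fixes C t :: int
  assumes p: "prime (p::nat)" and C: "\<not> int (p ^ Suc m) dvd C"
  shows "(\<Sum>i<p ^ Suc m. of_bool (int (p ^ Suc m) dvd int i * C + t - int (p ^ m)) :: int)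
       = (\<Sum>i<p ^ Suc m. of_bool (int (p ^ Suc m) dvd int i * C + t))"
proof -
  define q where "q = p ^ Suc m"
  have q: "q > 0"
    unfolding q_def using p prime_gt_0_nat by simp
  have "prime (int p)"
    using p by simp
  moreover have "gcd C (int q) dvd int p ^ Suc m"
    by (simp add: q_def)
  ultimately obtain e where e: "e \<le> Suc m" "normalize (gcd C (int q)) = int p ^ e"
    by (rule divides_primepow)
  then have gcd: "gcd C (int q) = int p ^ e"
    by simp
  have "e \<noteq> Suc m"
    using C gcd by (metis gcd_dvd1 of_nat_power)
  then have "e \<le> m"
    using e by simp
  obtain u v where uv: "u * C + v * int q = int p ^ e"
    using bezout_int[of C "int q"] gcd by auto
  \<comment> \<open>The Bezout identity multiplied by \<open>p ^ (m - e)\<close> makes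
    \<open>k * C\<close> congruent to \<open>p ^ m\<close> modulo \<open>q\<close>; shifting the
    index by \<open>k\<close> realises the translation.\<close>
  define k where "k = nat ((u * int p ^ (m - e)) mod int q)"
  have "int q dvd int k - u * int p ^ (m - e)"
    unfolding k_def using q by (simp flip: mod_eq_dvd_iff)
  then have "int q dvd (int k - u * int p ^ (m - e)) * C"
    by (rule dvd_mult2)
  moreover have "(int k - u * int p ^ (m - e)) * C
      = int k * C - int (p ^ m) + int q * (v * int p ^ (m - e))"
  proof -
    have "int (p ^ m) = int p ^ e * int p ^ (m - e)"
      using \<open>e \<le> m\<close> by (simp flip: power_add)
    also have "\<dots> = (u * C + v * int q) * int p ^ (m - e)"
      using uv by simp
    finally show ?thesis
      by (simp add: algebra_simps)
  qed
  ultimately have k: "int q dvd int k * C - int (p ^ m)"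
    by (simp only: dvd_add_left_iff[OF dvd_triv_left])
  define F where "F i = (of_bool (int q dvd int i * C + t - int (p ^ m)) :: int)" for i
  have "F (i + q) = F i" for i
  proof -
    have "int (i + q) * C + t - int (p ^ m) = (int i * C + t - int (p ^ m)) + int q * C"
      by (simp add: algebra_simps)
    then show ?thesis
      unfolding F_def by (simp only: dvd_add_times_triv_right_iff mult.commute[of "int q"])
  qed
  then have "(\<Sum>i<q. F i) = (\<Sum>i<q. F (i + k))"
    by (rule periodic_sum_shift[symmetric])
  also have "\<dots> = (\<Sum>i<q. of_bool (int q dvd int i * C + t))"
  proof (rule sum.cong[OF refl])
    fix i
    have "int (i + k) * C + t - int (p ^ m) = (int i * C + t) + (int k * C - int (p ^ m))"
      by (simp add: algebra_simps)
    then show "F (i + k) = of_bool (int q dvd int i * C + t)"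
      unfolding F_def by (simp only: dvd_add_left_iff[OF k])
  qed
  finally show ?thesis
    unfolding F_def q_def .
qed

section \<open>Cosets and powers\<close>

context group
begin

lemma conj_nat_pow:
  assumes "h \<in> carrier G" "x \<in> carrier G"
  shows "(h \<otimes> x \<otimes> inv h) [^] (n::nat) = h \<otimes> x [^] n \<otimes> inv h"
proof (induction n)
  case (Suc n)
  have "inv h \<otimes> (h \<otimes> (x \<otimes> inv h)) = x \<otimes> inv h"
    using assms by (simp flip: m_assoc)
  then show ?case
    using assms Suc by (simp add: m_assoc)
qed (use assms in simp)

lemma conj_int_pow:
  assumes "g \<in> carrier G" "c \<in> carrier G"
  shows "(g \<otimes> c \<otimes> inv g) [^] (k::int) = g \<otimes> c [^] k \<otimes> inv g"
proof (cases k rule: int_cases2)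
  case (nonneg n)
  then show ?thesis
    using assms by (simp add: int_pow_int conj_nat_pow)
next
  case (nonpos n)
  then show ?thesis
    using assms by (simp add: int_pow_neg_int conj_nat_pow) (simp add: inv_mult_group m_assoc)
qed

lemma normal_mem_carrier: "N \<lhd> G \<Longrightarrow> x \<in> N \<Longrightarrow> x \<in> carrier G"
  by (rule subgroup.mem_carrier[OF normal_imp_subgroup])

lemma coset_in_rcosets: "N \<lhd> G \<Longrightarrow> x \<in> carrier G \<Longrightarrow> N #> x \<in> rcosets N"
  by (rule rcosetsI) (auto dest: normal_mem_carrier)

lemma coset_eq_iff:
  assumes "N \<lhd> G" "x \<in> carrier G" "y \<in> carrier G"
  shows "N #> x = N #> y \<longleftrightarrow> x \<otimes> inv y \<in> N"
proof -
  have "subgroup N G"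
    using assms(1) by (rule normal_imp_subgroup)
  then show ?thesis
    using assms repr_independence[of x N y] rcos_self[of x N]
      subgroup.rcos_module[OF _ is_group, of N y x] by blast
qed

lemma coset_eq_one_iff:
  "N \<lhd> G \<Longrightarrow> x \<in> carrier G \<Longrightarrow> N #> x = N #> \<one> \<longleftrightarrow> x \<in> N"
  by (simp add: coset_eq_iff)

lemma coset_mult_right_iff:
  assumes "N \<lhd> G" "x \<in> carrier G" "y \<in> carrier G" "g \<in> carrier G"
  shows "N #> (x \<otimes> g) = N #> (y \<otimes> g) \<longleftrightarrow> N #> x = N #> y"
proof -
  have "x \<otimes> g \<otimes> inv (y \<otimes> g) = x \<otimes> inv y"
    using assms by (simp add: inv_mult_group m_assoc) (simp flip: m_assoc)
  then show ?thesis
    using assms by (simp add: coset_eq_iff)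
qed

lemma coset_mult_left:
  assumes "N \<lhd> G" "x \<in> carrier G" "y \<in> carrier G" "g \<in> carrier G" "N #> x = N #> y"
  shows "N #> (g \<otimes> x) = N #> (g \<otimes> y)"
proof -
  have "g \<otimes> x \<otimes> inv (g \<otimes> y) = g \<otimes> (x \<otimes> inv y) \<otimes> inv g"
    using assms by (simp add: inv_mult_group m_assoc)
  then show ?thesis
    using assms normal.inv_op_closed2[OF assms(1), of g "x \<otimes> inv y"] by (simp add: coset_eq_iff)
qed

lemma coset_mult_left_iff:
  assumes "N \<lhd> G" "x \<in> carrier G" "y \<in> carrier G" "g \<in> carrier G"
  shows "N #> (g \<otimes> x) = N #> (g \<otimes> y) \<longleftrightarrow> N #> x = N #> y"
proof
  assume "N #> (g \<otimes> x) = N #> (g \<otimes> y)"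
  then have "N #> (inv g \<otimes> (g \<otimes> x)) = N #> (inv g \<otimes> (g \<otimes> y))"
    by (rule coset_mult_left[rotated 4]) (use assms in simp_all)
  moreover have "inv g \<otimes> (g \<otimes> x) = x" "inv g \<otimes> (g \<otimes> y) = y"
    using assms by (simp_all flip: m_assoc)
  ultimately show "N #> x = N #> y"
    by simp
qed (rule coset_mult_left[OF assms])

lemma coset_mult_normal:
  assumes "N \<lhd> G" "x \<in> N" "g \<in> carrier G"
  shows "N #> (g \<otimes> x) = N #> g"
proof -
  have "x \<in> carrier G"
    using normal_mem_carrier[OF assms(1,2)] .
  moreover from this have "N #> x = N #> \<one>"
    using coset_eq_one_iff[OF assms(1)] assms(2) by blast
  ultimately have "N #> (g \<otimes> x) = N #> (g \<otimes> \<one>)"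
    using assms(1,3) by (intro coset_mult_left) simp_all
  then show ?thesis
    using assms(3) by simp
qed

lemma subgroup_nat_pow_closed:
  "subgroup N G \<Longrightarrow> x \<in> N \<Longrightarrow> x [^] (n::nat) \<in> N"
  using subgroup_int_pow_closed[of N x "int n"] by (simp add: int_pow_int)

text \<open>A map \<open>F\<close> of finite range that tells the cosets of \<open>N\<close> apart
  bounds their number. It is applied to pairs of cosets and to tables of residues.\<close>

lemma finite_rcosetsI:
  assumes N: "N \<lhd> G" and fin: "finite (F ` carrier G)"
    and F: "\<And>x y. x \<in> carrier G \<Longrightarrow> y \<in> carrier G \<Longrightarrow> F x = F y \<Longrightarrow> x \<otimes> inv y \<in> N"
  shows "finite (rcosets N)"
proof (rule finite_subset)
  show "rcosets N \<subseteq> (\<lambda>v. N #> inv_into (carrier G) F v) ` F ` carrier G"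
  proof
    fix C
    assume "C \<in> rcosets N"
    then obtain x where x: "x \<in> carrier G" "C = N #> x"
      unfolding RCOSETS_def by blast
    define y where "y = inv_into (carrier G) F (F x)"
    have "y \<in> carrier G" "F y = F x"
      unfolding y_def using x by (auto intro: inv_into_into f_inv_into_f)
    then have "C = N #> y"
      using x F[of x y] coset_eq_iff[OF N, of x y] by simp
    then show "C \<in> (\<lambda>v. N #> inv_into (carrier G) F v) ` F ` carrier G"
      unfolding y_def using x by blast
  qed
qed (use fin in simp)

lemma finite_rcosets_Int:
  assumes "M \<lhd> G" "N \<lhd> G" "finite (rcosets M)" "finite (rcosets N)"
  shows "finite (rcosets (M \<inter> N))"
proof (rule finite_rcosetsI[where F = "\<lambda>x. (M #> x, N #> x)"])
  show "M \<inter> N \<lhd> G"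
    using assms by (simp add: normal_subgroup_intersect)
  have "(\<lambda>x. (M #> x, N #> x)) ` carrier G \<subseteq> (rcosets M) \<times> (rcosets N)"
    using assms by (auto intro!: coset_in_rcosets)
  then show "finite ((\<lambda>x. (M #> x, N #> x)) ` carrier G)"
    using assms finite_subset by blast
next
  fix x y
  assume "x \<in> carrier G" "y \<in> carrier G" "(M #> x, N #> x) = (M #> y, N #> y)"
  then show "x \<otimes> inv y \<in> M \<inter> N"
    using assms by (auto simp: coset_eq_iff)
qed

lemma carrier_normal: "carrier G \<lhd> G"
  unfolding normal_inv_iff by (simp add: subgroup_self)

text \<open>The value is 0 when no positive power of \<open>x\<close> lies in \<open>N\<close>. For
  a word it counts the repetitions after which its path in the Cayley graph of the quotient closes
  up.\<close>

definition period :: "'a set \<Rightarrow> 'a \<Rightarrow> nat" where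
  "period N x = group.ord (G Mod N) (N #> x)"

lemma pow_mem_normal_iff:
  assumes N: "N \<lhd> G" and x: "x \<in> carrier G"
  shows "x [^] (n::nat) \<in> N \<longleftrightarrow> period N x dvd n"
proof -
  interpret normal N G by (rule N)
  interpret Q: group "G Mod N" by (rule factorgroup_is_group)
  have "N #> x \<in> carrier (G Mod N)"
    using x by (auto simp: carrier_FactGroup)
  then have "period N x dvd n \<longleftrightarrow> N #> (x [^] n) = N"
    unfolding period_def using Q.pow_eq_id[of "N #> x" n] FactGroup_pow[OF x, of n] by simp
  also have "\<dots> \<longleftrightarrow> N #> (x [^] n) = N #> \<one>"
    using subset by simp
  finally show ?thesis
    using coset_eq_one_iff[OF N, of "x [^] n"] x by simp
qed

text \<open>Used in contrapositive form: one inequality between cosets, namely failure to commute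
  with \<open>x\<close> modulo \<open>N\<close>, excludes that \<open>y\<close> is congruent to any
  of the infinitely many powers of \<open>x\<close>.\<close>

lemma coset_int_pow_commutes:
  assumes N: "N \<lhd> G" and "x \<in> carrier G" "y \<in> carrier G" and eq: "N #> y = N #> (x [^] (e::int))"
  shows "N #> (y \<otimes> x) = N #> (x \<otimes> y)"
proof -
  have "x [^] e \<otimes> x = x [^] (e + 1)" "x \<otimes> x [^] e = x [^] (1 + e)"
    using assms(2) by (simp_all add: int_pow_mult)
  then have "x [^] e \<otimes> x = x \<otimes> x [^] e"
    by (simp add: add.commute)
  then show ?thesis
    using coset_mult_right_iff[OF N, of y "x [^] e" x] coset_mult_left_iff[OF N, of y "x [^] e" x]
      assms by simp
qed

lemma coset_solve_pow:
  assumes N: "N \<lhd> G" and x: "x \<in> carrier G" and yz: "y \<in> carrier G" "z \<in> carrier G"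
    and eq: "N #> (x [^] (k::nat) \<otimes> y) = N #> (x [^] (m::nat) \<otimes> z)"
  shows "N #> (y \<otimes> inv z) = N #> (x [^] (int m - int k))"
proof -
  have "N #> (inv (x [^] k) \<otimes> (x [^] k \<otimes> y)) = N #> (inv (x [^] k) \<otimes> (x [^] m \<otimes> z))"
    by (rule coset_mult_left[OF N _ _ _ eq]) (use x yz in simp_all)
  moreover have "inv (x [^] k) \<otimes> (x [^] k \<otimes> y) = y"
    using x yz by (simp flip: m_assoc)
  moreover have "inv (x [^] k) \<otimes> x [^] m = x [^] (int m - int k)"
  proof -
    have "inv (x [^] k) \<otimes> x [^] m = x [^] (- int k) \<otimes> x [^] int m"
      using x by (simp only: int_pow_neg_int int_pow_int)
    also have "\<dots> = x [^] (- int k + int m)"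
      using x by (rule int_pow_mult[symmetric])
    finally show ?thesis
      by simp
  qed
  then have "inv (x [^] k) \<otimes> (x [^] m \<otimes> z) = x [^] (int m - int k) \<otimes> z"
    using x yz by (simp flip: m_assoc)
  ultimately have "N #> y = N #> (x [^] (int m - int k) \<otimes> z)"
    by simp
  then have "N #> (y \<otimes> inv z) = N #> (x [^] (int m - int k) \<otimes> z \<otimes> inv z)"
    using coset_mult_right_iff[OF N] x yz by simp
  then show ?thesis
    using x yz by (simp add: m_assoc)
qed

lemma finite_transversal:
  assumes N: "N \<lhd> G" and fin: "finite (rcosets N)"
  shows "\<exists>R \<subseteq> carrier G. finite R \<and> (\<forall>g \<in> carrier G. \<exists>r \<in> R. N #> g = N #> r)"
proof -
  define f where "f C = (SOME h. h \<in> carrier G \<and> N #> h = C)" for C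
  have f: "f C \<in> carrier G \<and> N #> f C = C" if C: "C \<in> rcosets N" for C
  proof -
    obtain h where "h \<in> carrier G \<and> N #> h = C"
      using C unfolding RCOSETS_def by blast
    then show ?thesis
      unfolding f_def by (rule someI)
  qed
  show ?thesis
  proof (intro exI[of _ "f ` (rcosets N)"] conjI ballI)
    show "f ` (rcosets N) \<subseteq> carrier G" "finite (f ` (rcosets N))"
      using f fin by auto
    show "\<exists>r\<in>f ` (rcosets N). N #> g = N #> r" if "g \<in> carrier G" for g
      using f[OF coset_in_rcosets[OF N that]] coset_in_rcosets[OF N that] by (metis imageI)
  qed
qed

lemma conj_mem_normal_iff:
  assumes N: "N \<lhd> G" and "h \<in> carrier G" "x \<in> carrier G"
  shows "h \<otimes> x \<otimes> inv h \<in> N \<longleftrightarrow> x \<in> N"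
proof
  assume "h \<otimes> x \<otimes> inv h \<in> N"
  then have "inv h \<otimes> (h \<otimes> x \<otimes> inv h) \<otimes> h \<in> N"
    using normal.inv_op_closed1[OF N] assms by blast
  moreover have "inv h \<otimes> (h \<otimes> x \<otimes> inv h) \<otimes> h = (inv h \<otimes> h) \<otimes> x \<otimes> (inv h \<otimes> h)"
    using assms by (simp only: m_assoc inv_closed m_closed)
  ultimately show "x \<in> N"
    using assms by simp
qed (use normal.inv_op_closed2[OF N] assms in blast)

text \<open>For a prime \<open>q\<close> dividing the order there is an element whose order is
  \<open>q\<close>; this order divides a power of \<open>p\<close>, so \<open>q = p\<close>. Hence
  the part of the order prime to \<open>p\<close> has no prime factor.\<close>

lemma order_prime_power:
  assumes p: "prime (p::nat)" and fin: "finite (carrier G)"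
    and pow: "\<And>x. x \<in> carrier G \<Longrightarrow> \<exists>k. x [^] (p ^ k) = \<one>"
  shows "\<exists>k. order G = p ^ k"
proof -
  have only_p: "q = p" if q: "prime q" "q dvd order G" for q
  proof -
    obtain m where "order G = q ^ 1 * m"
      using q(2) by (auto simp: dvd_def)
    \<comment> \<open>Sylow's theorem with exponent 1 serves as Cauchy's theorem.\<close>
    then obtain H where H: "subgroup H G" "card H = q"
      using sylow_thm[OF q(1) is_group _ fin, of 1 m] by auto
    then have "H \<noteq> {\<one>}" "\<one> \<in> H"
      using q(1) by (auto simp: subgroup.one_closed)
    then obtain x where x: "x \<in> H" "x \<noteq> \<one>"
      by blast
    have xG: "x \<in> carrier G"
      using subgroup.mem_carrier[OF H(1) x(1)] .
    interpret H: group "G\<lparr>carrier := H\<rparr>"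
      by (rule subgroup_imp_group[OF H(1)])
    have "x [^] q = \<one>"
      using H.pow_order_eq_1[of x] x(1) H(2) nat_pow_consistent[of x q H] by (simp add: order_def)
    then have "ord x dvd q"
      using pow_eq_id[OF xG] by simp
    moreover obtain k where "ord x dvd p ^ k"
      using pow[OF xG] pow_eq_id[OF xG] by blast
    moreover have "ord x \<noteq> 1"
      using ord_eq_1[OF xG] x(2) by simp
    ultimately have "q dvd p ^ k"
      using q(1) by (auto simp: prime_nat_iff)
    then show ?thesis
      using q(1) p by (metis prime_dvd_power_nat primes_dvd_imp_eq)
  qed
  have "order G \<noteq> 0"
    using fin order_gt_0_iff_finite by simp
  moreover have "\<not> is_unit p"
    using p by auto
  ultimately obtain m where m: "order G = p ^ multiplicity p (order G) * m" "\<not> p dvd m"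
    by (rule multiplicity_decompose')
  have "m = 1"
  proof (rule ccontr)
    assume "m \<noteq> 1"
    then obtain q where q: "prime q" "q dvd m"
      using prime_factor_nat by blast
    then have "q = p"
      using only_p m(1) by (metis dvd_mult)
    then show False
      using q m(2) by simp
  qed
  then show ?thesis
    using m(1) by auto
qed

end

section \<open>Reduced words and flows in a free group\<close>

locale based_free_group = group G for G (structure) +
  fixes S
  assumes basis: "free_basis G S"
begin

abbreviation "wv \<equiv> word_value G"

lemma basis_closed: "s \<in> S \<Longrightarrow> s \<in> carrier G"
  using basis unfolding free_basis_def by blast

lemma letter_value_closed: "fst l \<in> S \<Longrightarrow> letter_value G l \<in> carrier G"
  by (cases l) (auto intro: basis_closed)

lemma wv_Nil [simp]: "wv [] = \<one>"
  by (simp add: word_value_def)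

lemma wv_Cons [simp]: "wv (l # w) = letter_value G l \<otimes> wv w"
  by (simp add: word_value_def)

lemma wv_closed: "set w \<subseteq> S \<times> UNIV \<Longrightarrow> wv w \<in> carrier G"
  by (induction w) (auto simp: mem_Times_iff letter_value_closed simp del: letter_value.simps)

lemma wv_append:
  "set v \<subseteq> S \<times> UNIV \<Longrightarrow> set w \<subseteq> S \<times> UNIV \<Longrightarrow> wv (v @ w) = wv v \<otimes> wv w"
  by (induction v) (auto simp: mem_Times_iff m_assoc letter_value_closed wv_closed simp del: letter_value.simps)

lemma letter_value_inv:
  "fst l \<in> S \<Longrightarrow> letter_value G (letter_inv l) = inv (letter_value G l)"
  by (cases l) (auto simp: basis_closed)

lemma word_inv_letters: "set w \<subseteq> S \<times> UNIV \<Longrightarrow> set (word_inv w) \<subseteq> S \<times> UNIV"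
  by auto

lemma wv_word_inv: "set w \<subseteq> S \<times> UNIV \<Longrightarrow> wv (word_inv w) = inv (wv w)"
proof (induction w)
  case (Cons l w)
  then have l: "fst l \<in> S" and w: "set w \<subseteq> S \<times> UNIV"
    by (auto simp: mem_Times_iff)
  have "set (word_inv w) \<subseteq> S \<times> UNIV" "set [letter_inv l] \<subseteq> S \<times> UNIV"
    using l word_inv_letters[OF w] by (auto simp: mem_Times_iff)
  then show ?case
    using Cons.IH l w wv_append[of "word_inv w" "[letter_inv l]"]
    by (simp add: letter_value_inv inv_mult_group letter_value_closed wv_closed
        del: letter_value.simps)
qed simp

lemma word_pow_letters: "set w \<subseteq> S \<times> UNIV \<Longrightarrow> set (word_pow w n) \<subseteq> S \<times> UNIV"
  by (rule subset_trans[OF set_word_pow])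

lemma wv_word_pow: "set w \<subseteq> S \<times> UNIV \<Longrightarrow> wv (word_pow w n) = wv w [^] n"
proof (induction n)
  case (Suc n)
  then show ?case
    using wv_append[OF word_pow_letters, of w w n]
    unfolding word_pow_Suc2 by simp
qed simp

abbreviation reduced :: "'a gword \<Rightarrow> bool" where
  "reduced w \<equiv> w \<in> reduced_words S"

lemma reduced_iff:
  "reduced w \<longleftrightarrow> set w \<subseteq> S \<times> UNIV \<and> successively (\<lambda>l m. m \<noteq> letter_inv l) w"
proof -
  have eq: "(\<lambda>(x, a) (y, b). \<not> (x = y \<and> a \<noteq> b)) = (\<lambda>l m. m \<noteq> letter_inv l)"
    by (auto simp: fun_eq_iff)
  show ?thesis
    unfolding reduced_words_def mem_Collect_eq eq ..
qed

lemma reduced_letters: "reduced w \<Longrightarrow> set w \<subseteq> S \<times> UNIV"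
  by (simp add: reduced_iff)

lemma reduced_append_iff:
  "reduced (v @ w) \<longleftrightarrow> reduced v \<and> reduced w \<and> (v \<noteq> [] \<longrightarrow> w \<noteq> [] \<longrightarrow> hd w \<noteq> letter_inv (last v))"
  unfolding reduced_iff successively_append_iff by auto

lemma reduced_take: "reduced w \<Longrightarrow> reduced (take n w)"
  by (metis append_take_drop_id reduced_append_iff)

definition nf :: "'a \<Rightarrow> 'a gword" where
  "nf x = the_inv_into (reduced_words S) wv x"

lemma wv_inj: "reduced v \<Longrightarrow> reduced w \<Longrightarrow> wv v = wv w \<Longrightarrow> v = w"
  using basis unfolding free_basis_def bij_betw_def inj_on_def by blast

lemma reduced_nf: "x \<in> carrier G \<Longrightarrow> reduced (nf x)"
  and wv_nf: "x \<in> carrier G \<Longrightarrow> wv (nf x) = x"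
  using basis unfolding free_basis_def nf_def bij_betw_def
  by (auto simp: the_inv_into_into f_the_inv_into_f)

lemma nf_wv: "reduced w \<Longrightarrow> nf (wv w) = w"
  using basis unfolding free_basis_def nf_def bij_betw_def by (simp add: the_inv_into_f_f)

lemma nf_letters: "x \<in> carrier G \<Longrightarrow> set (nf x) \<subseteq> S \<times> UNIV"
  using reduced_nf reduced_letters by blast

lemma reduced_Nil [simp]: "reduced []"
  by (simp add: reduced_iff)

text \<open>
  In the Cayley graph the edge labelled \<open>s \<in> S\<close> with source \<open>g\<close> ends at \<open>g \<otimes> s\<close>; an inverse letter
  traverses an edge backwards.
\<close>

abbreviation edge_source :: "'a \<Rightarrow> 'a \<times> bool \<Rightarrow> 'a" where
  "edge_source g l \<equiv> (if snd l then g else g \<otimes> inv (fst l))"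

abbreviation letter_sign :: "'a \<times> bool \<Rightarrow> int" where
  "letter_sign l \<equiv> (if snd l then 1 else - 1)"

text \<open>Here \<open>f h s\<close> is the weight of the edge with source \<open>h\<close> and
  label \<open>s\<close>. Backward traversal counts negatively, so that backtracking contributes
  nothing.\<close>

fun path_sum :: "('a \<Rightarrow> 'a \<Rightarrow> int) \<Rightarrow> 'a \<Rightarrow> 'a gword \<Rightarrow> int" where
  "path_sum f g [] = 0"
| "path_sum f g (l # w) =
     letter_sign l * f (edge_source g l) (fst l) + path_sum f (g \<otimes> letter_value G l) w"

lemma path_sum_append:
  "set v \<subseteq> S \<times> UNIV \<Longrightarrow> set w \<subseteq> S \<times> UNIV \<Longrightarrow> g \<in> carrier G \<Longrightarrow>
   path_sum f g (v @ w) = path_sum f g v + path_sum f (g \<otimes> wv v) w"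
proof (induction v arbitrary: g)
  case (Cons l v)
  then have "g \<otimes> letter_value G l \<in> carrier G" "fst l \<in> S" "set v \<subseteq> S \<times> UNIV"
    by (auto simp: mem_Times_iff letter_value_closed simp del: letter_value.simps)
  with Cons show ?case
    by (simp add: m_assoc letter_value_closed wv_closed del: letter_value.simps)
qed simp

lemma path_sum_cancel:
  assumes "fst l \<in> S" and "g \<in> carrier G"
  shows "path_sum f g [l, letter_inv l] = 0"
proof (cases l)
  case (Pair s b)
  have "s \<in> carrier G"
    using assms Pair basis_closed by auto
  then have "g \<otimes> inv s \<otimes> s = g" "g \<otimes> s \<otimes> inv s = g"
    using assms(2) by (simp_all add: m_assoc)
  then show ?thesis
    using Pair by simp
qed

text \<open>Deleting an adjacent pair of inverse letters changes neither the value nor any path sum,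
  and it shortens the word.\<close>

lemma reduction_exists:
  "set w \<subseteq> S \<times> UNIV \<Longrightarrow>
   \<exists>v. reduced v \<and> wv v = wv w \<and> (\<forall>f. \<forall>g \<in> carrier G. path_sum f g v = path_sum f g w)"
proof (induction "length w" arbitrary: w rule: less_induct)
  case less
  show ?case
  proof (cases "reduced w")
    case True
    then show ?thesis by auto
  next
    case False
    then obtain i where i: "Suc i < length w" "w ! Suc i = letter_inv (w ! i)"
      using less.prems unfolding reduced_iff successively_conv_nth by blast
    define a c l where "a = take i w" and "c = drop (Suc (Suc i)) w" and "l = w ! i"
    have w: "w = a @ [l, letter_inv l] @ c"
      using i id_take_nth_drop[of i w] Cons_nth_drop_Suc[of "Suc i" w]
      unfolding a_def c_def l_def by simp
    have let1: "set a \<subseteq> S \<times> UNIV" "set c \<subseteq> S \<times> UNIV" "fst l \<in> S" "set [l, letter_inv l] \<subseteq> S \<times> UNIV"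
      using less.prems w by (auto simp: mem_Times_iff)
    have let2: "set ([l, letter_inv l] @ c) \<subseteq> S \<times> UNIV" "set (a @ c) \<subseteq> S \<times> UNIV"
      using let1 by auto
    have one: "wv [l, letter_inv l] = \<one>"
      using let1(3) by (simp add: letter_value_inv letter_value_closed del: letter_value.simps)
    have v: "wv w = wv (a @ c)"
      unfolding w wv_append[OF let1(1) let2(1)] wv_append[OF let1(4,2)] wv_append[OF let1(1,2)] one
      using let1 by (simp add: wv_closed)
    have p: "path_sum f g w = path_sum f g (a @ c)" if "g \<in> carrier G" for f g
    proof -
      have "g \<otimes> wv a \<in> carrier G"
        using that let1 by (simp add: wv_closed)
      then show ?thesis
        unfolding w path_sum_append[OF let1(1) let2(1) that]
          path_sum_append[OF let1(1,2) that] path_sum_append[OF let1(4,2) \<open>g \<otimes> wv a \<in> carrier G\<close>]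
          one path_sum_cancel[OF let1(3) \<open>g \<otimes> wv a \<in> carrier G\<close>]
        by simp
    qed
    have "length (a @ c) < length w"
      by (simp add: w)
    from less.hyps[OF this let2(2)] show ?thesis
      using v p by auto
  qed
qed

section \<open>Flows of group elements\<close>

definition flow :: "('a \<Rightarrow> 'a \<Rightarrow> int) \<Rightarrow> 'a \<Rightarrow> 'a \<Rightarrow> int" where
  "flow f x g = path_sum f g (nf x)"

text \<open>By free reduction any word for the element may replace its normal form, so the flow
  depends on the element alone.\<close>

lemma flow_wv:
  assumes "set w \<subseteq> S \<times> UNIV" and "g \<in> carrier G"
  shows "flow f (wv w) g = path_sum f g w"
proof -
  obtain v where v: "reduced v" "wv v = wv w" "path_sum f g v = path_sum f g w"
    using reduction_exists[OF assms(1)] assms(2) by blast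
  then have "nf (wv w) = v"
    using nf_wv by metis
  then show ?thesis
    unfolding flow_def using v by simp
qed

text \<open>The cocycle identity: a path for \<open>x\<close> is followed by a path for
  \<open>y\<close> that starts where the first one ends.\<close>

lemma flow_mult:
  assumes "x \<in> carrier G" and "y \<in> carrier G" and "g \<in> carrier G"
  shows "flow f (x \<otimes> y) g = flow f x g + flow f y (g \<otimes> x)"
proof -
  have "x \<otimes> y = wv (nf x @ nf y)"
    using assms by (simp add: wv_append nf_letters wv_nf)
  then have "flow f (x \<otimes> y) g = path_sum f g (nf x @ nf y)"
    using assms nf_letters flow_wv[of "nf x @ nf y" g f] by simp
  then show ?thesis
    using assms by (simp add: path_sum_append nf_letters wv_nf flow_def)
qed

lemma flow_one: "g \<in> carrier G \<Longrightarrow> flow f \<one> g = 0"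
  using flow_wv[of "[]" g f] by simp

lemma flow_inv:
  assumes "x \<in> carrier G" and "g \<in> carrier G"
  shows "flow f (inv x) g = - flow f x (g \<otimes> inv x)"
proof -
  have "flow f (inv x \<otimes> x) g = flow f (inv x) g + flow f x (g \<otimes> inv x)"
    by (rule flow_mult) (use assms in auto)
  then show ?thesis
    using assms by (simp add: flow_one)
qed

section \<open>Cancellation, root words and their centralizers\<close>

lemma reduced_product:
  "reduced a \<Longrightarrow> reduced b \<Longrightarrow>
   \<exists>a' c b'. a = a' @ c \<and> b = word_inv c @ b' \<and> reduced (a' @ b')"
proof (induction a arbitrary: b rule: rev_induct)
  case Nil
  then show ?case by auto
next
  case (snoc l a)
  show ?case
  proof (cases "reduced ((a @ [l]) @ b)")
    case True
    then show ?thesis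
      by (intro exI[of _ "a @ [l]"] exI[of _ "[]"] exI[of _ b]) auto
  next
    case False
    \<comment> \<open>If the product is not reduced, the only fault is at the junction:
      \<open>b\<close> starts with the inverse of \<open>l\<close>. This pair is moved into the
      cancelled part \<open>c\<close>.\<close>
    then obtain b1 where b: "b = letter_inv l # b1"
      using snoc.prems unfolding reduced_append_iff[of "a @ [l]"] by (cases b) auto
    have "reduced a" "reduced b1"
      using snoc.prems reduced_append_iff[of "[letter_inv l]" b1] reduced_append_iff[of a "[l]"]
      unfolding b by auto
    then obtain a' c b' where "a = a' @ c" "b1 = word_inv c @ b'" "reduced (a' @ b')"
      using snoc.IH by blast
    then show ?thesis
      by (intro exI[of _ a'] exI[of _ "c @ [l]"] exI[of _ b']) (simp add: b)
  qed
qed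

text \<open>Reducedness of \<open>w @ w\<close> encodes that \<open>w\<close> is cyclically reduced:
  nothing cancels between its end and its beginning.\<close>

definition root_word :: "'a gword \<Rightarrow> bool" where
  "root_word w \<longleftrightarrow> reduced (w @ w) \<and> primitive_word w"

lemma root_word_nonempty: "root_word w \<Longrightarrow> w \<noteq> []"
  by (simp add: root_word_def primitive_word_def)

lemma root_word_letters: "root_word w \<Longrightarrow> set w \<subseteq> S \<times> UNIV"
  unfolding root_word_def reduced_append_iff using reduced_letters by blast

lemma root_word_closed: "root_word w \<Longrightarrow> wv w \<in> carrier G"
  by (simp add: root_word_letters wv_closed)

lemma reduced_word_pow:
  assumes "reduced (w @ w)"
  shows "reduced (word_pow w n)"
proof (induction n)
  case (Suc n)
  show ?case
  proof (cases n)
    case (Suc m)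
    then show ?thesis
      using Suc.IH assms unfolding reduced_append_iff[of w w]
      by (cases "w = []") (auto simp: reduced_append_iff[of w])
  qed (use assms reduced_append_iff in auto)
qed simp

lemma prefix_closed: "set w \<subseteq> S \<times> UNIV \<Longrightarrow> wv (take i w) \<in> carrier G"
  by (rule wv_closed) (meson set_take_subset subset_trans)

lemma reduced_overlap:
  "reduced (a @ b) \<Longrightarrow> reduced (b @ c) \<Longrightarrow> b \<noteq> [] \<Longrightarrow> reduced (a @ b @ c)"
  by (simp add: reduced_append_iff)

lemma wv_cancel_middle:
  assumes "set (a @ c) \<subseteq> S \<times> UNIV" and "set b \<subseteq> S \<times> UNIV"
  shows "wv (a @ c) \<otimes> wv (word_inv c @ b) = wv (a @ b)"
proof -
  have l: "set a \<subseteq> S \<times> UNIV" "set c \<subseteq> S \<times> UNIV" "set (word_inv c) \<subseteq> S \<times> UNIV"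
    using assms by auto
  note closed = l[THEN wv_closed] assms(2)[THEN wv_closed]
  have "wv c \<otimes> (inv (wv c) \<otimes> wv b) = wv b"
    using closed by (simp flip: m_assoc)
  then show ?thesis
    unfolding wv_append[OF l(1,2)] wv_append[OF l(3) assms(2)] wv_append[OF l(1) assms(2)]
      wv_word_inv[OF l(2)]
    using closed by (simp add: m_assoc)
qed

text \<open>Cancellation against \<open>y\<close> consumes at most \<open>length (nf y)\<close>
  letters, hence at most that many copies of \<open>w\<close>, and spares the last \<open>d\<close>
  copies. The next lemma is the mirror image.\<close>

lemma nf_mult_pow_suffix:
  assumes w: "reduced (w @ w)" "w \<noteq> []" and y: "y \<in> carrier G" and m: "length (nf y) + d \<le> m"
  shows "\<exists>u. nf (y \<otimes> wv w [^] m) = u @ word_pow w d"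
proof -
  have letters: "set w \<subseteq> S \<times> UNIV"
    using w reduced_append_iff reduced_letters by blast
  obtain a c b where *: "nf y = a @ c" "word_pow w m = word_inv c @ b" "reduced (a @ b)"
    using reduced_product[OF reduced_nf[OF y] reduced_word_pow[OF w(1)]] by blast
  have "y \<otimes> wv w [^] m = wv (nf y) \<otimes> wv (word_pow w m)"
    using y letters by (simp add: wv_nf wv_word_pow)
  also have "\<dots> = wv (a @ b)"
    using * reduced_nf[OF y] reduced_letters[OF *(3)] reduced_letters[of "a @ c"]
    by (simp add: wv_cancel_middle)
  finally have "nf (y \<otimes> wv w [^] m) = a @ b"
    using nf_wv *(3) by simp
  moreover have "b = drop (length c) (word_pow w (m - d)) @ word_pow w d"
  proof -
    have "length c \<le> (m - d) * 1"
      using m *(1) by simp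
    also have "\<dots> \<le> length (word_pow w (m - d))"
      unfolding length_word_pow using w(2) by (intro mult_left_mono) (auto simp: Suc_le_eq)
    finally have "length c \<le> length (word_pow w (m - d))" .
    moreover have "word_pow w m = word_pow w (m - d) @ word_pow w d"
      using m word_pow_add[of "m - d" d w] by simp
    ultimately show ?thesis
      using arg_cong[OF *(2), of "drop (length c)"] by simp
  qed
  ultimately show ?thesis by auto
qed

lemma nf_pow_mult_prefix:
  assumes w: "reduced (w @ w)" "w \<noteq> []" and y: "y \<in> carrier G" and m: "length (nf y) + d \<le> m"
  shows "\<exists>u. nf (wv w [^] m \<otimes> y) = word_pow w d @ u"
proof -
  have letters: "set w \<subseteq> S \<times> UNIV"
    using w reduced_append_iff reduced_letters by blast
  obtain a c b where *: "word_pow w m = a @ c" "nf y = word_inv c @ b" "reduced (a @ b)"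
    using reduced_product[OF reduced_word_pow[OF w(1)] reduced_nf[OF y]] by blast
  have "wv w [^] m \<otimes> y = wv (word_pow w m) \<otimes> wv (nf y)"
    using y letters by (simp add: wv_nf wv_word_pow)
  also have "\<dots> = wv (a @ b)"
    using * reduced_word_pow[OF w(1), of m] reduced_letters[OF *(3)] reduced_letters[of "a @ c"]
    by (simp add: wv_cancel_middle)
  finally have "nf (wv w [^] m \<otimes> y) = a @ b"
    using nf_wv *(3) by simp
  moreover have "a = word_pow w d @ drop (d * length w) a"
  proof -
    have "length c \<le> (m - d) * 1"
      using m *(2) by simp
    also have "\<dots> \<le> (m - d) * length w"
      using w(2) by (intro mult_left_mono) (auto simp: Suc_le_eq)
    finally have "length c \<le> (m - d) * length w" .
    moreover have "length a + length c = m * length w"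
      using arg_cong[OF *(1), of length] by (simp only: length_word_pow length_append)
    moreover have "m * length w = (m - d) * length w + d * length w"
      using m by (simp flip: add_mult_distrib)
    ultimately have "d * length w \<le> length a"
      by simp
    moreover have "word_pow w m = word_pow w d @ word_pow w (m - d)"
      using m word_pow_add[of d "m - d" w] by simp
    ultimately have "take (d * length w) a = word_pow w d"
      using arg_cong[OF *(1), of "take (d * length w)"] length_word_pow[of d w] by simp
    then show ?thesis
      by (metis append_take_drop_id)
  qed
  ultimately show ?thesis
    by (metis append.assoc)
qed

text \<open>After multiplication by a high power of \<open>wv w\<close>, the commutation of
  \<open>y\<close> becomes an equation between reduced words, to which
  \<open>commutes_with_primitive_power\<close> applies.\<close>

lemma centralizer_root_power:
  assumes w: "root_word w" and "d \<ge> (1::nat)" and y: "y \<in> carrier G"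
    and comm: "y \<otimes> wv w [^] d = wv w [^] d \<otimes> y"
  shows "\<exists>i::int. y = wv w [^] i"
proof -
  define x where "x = wv w"
  \<comment> \<open>Large enough for \<open>d\<close> copies of \<open>w\<close> to survive
    cancellation with \<open>y\<close>, and a multiple of \<open>d\<close>, so that
    \<open>x [^] m\<close> commutes with \<open>y\<close>.\<close>
  define m where "m = d * Suc (length (nf y))"
  have w': "reduced (w @ w)" "w \<noteq> []" and prim: "primitive_word w"
    using w root_word_nonempty unfolding root_word_def by auto
  have letters: "set w \<subseteq> S \<times> UNIV" and x: "x \<in> carrier G"
    using root_word_letters root_word_closed w x_def by auto
  have red_pow: "reduced (word_pow w n)" for n
    by (rule reduced_word_pow[OF w'(1)])
  have "length (nf y) + d \<le> m"
    using \<open>d \<ge> 1\<close> mult_le_mono1[of 1 d "length (nf y)"] unfolding m_def by simp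
  then obtain u v where u: "nf (y \<otimes> x [^] m) = u @ word_pow w d"
    and v: "nf (x [^] m \<otimes> y) = word_pow w d @ v"
    unfolding x_def using nf_mult_pow_suffix nf_pow_mult_prefix w' y by metis
  have "(x [^] d) [^] Suc (length (nf y)) \<otimes> y = y \<otimes> (x [^] d) [^] Suc (length (nf y))"
    by (rule group_commutes_pow) (use comm x y in \<open>auto simp: x_def\<close>)
  then have z_eq: "x [^] m \<otimes> y = y \<otimes> x [^] m"
    using x by (simp only: nat_pow_pow m_def)
  define z where "z = y \<otimes> x [^] m"
  have z: "z \<in> carrier G"
    unfolding z_def using x y by simp
  have ne: "word_pow w d \<noteq> []"
    using \<open>d \<ge> 1\<close> w'(2) by (cases d) auto
  have "reduced (word_pow w d @ word_pow w d)"
    using red_pow[of "d + d"] unfolding word_pow_add .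
  moreover have nf_z: "nf z = u @ word_pow w d" "nf z = word_pow w d @ v"
    using u v z_eq by (simp_all only: z_def)
  \<comment> \<open>\<open>nf z\<close> both starts and ends with \<open>word_pow w d\<close>, whose
    square is reduced, so nothing cancels at either junction.\<close>
  ultimately have "reduced (nf z @ word_pow w d)" "reduced (word_pow w d @ nf z)"
    using reduced_nf[OF z] reduced_overlap[OF _ _ ne] by (metis append.assoc)+
  moreover have "wv (nf z @ word_pow w d) = wv (word_pow w d @ nf z)"
  proof -
    have "z \<otimes> x [^] d = y \<otimes> x [^] (m + d)"
      using x y by (simp add: z_def m_assoc nat_pow_mult)
    also have "\<dots> = y \<otimes> x [^] d \<otimes> x [^] m"
      using x y by (simp add: m_assoc nat_pow_mult add.commute)
    also have "\<dots> = x [^] d \<otimes> z"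
      using x y comm by (simp add: z_def x_def m_assoc)
    finally show ?thesis
      using z letters nf_letters[OF z] word_pow_letters[OF letters, of d]
      by (simp add: wv_append wv_nf wv_word_pow x_def del: set_concat)
  qed
  ultimately have "nf z @ word_pow w d = word_pow w d @ nf z"
    by (rule wv_inj)
  then obtain q where q: "nf z = word_pow w q"
    using commutes_with_primitive_power[OF prim \<open>d \<ge> 1\<close>] by blast
  have "y = z \<otimes> inv (x [^] m)"
    using x y by (simp add: z_def m_assoc)
  also have "z = x [^] q"
    using wv_nf[OF z] q wv_word_pow[OF letters] by (simp add: x_def)
  also have "x [^] q \<otimes> inv (x [^] m) = x [^] (int q - int m)"
    using x by (simp add: int_pow_diff int_pow_int)
  finally show ?thesis
    unfolding x_def by blast
qed

text \<open>Both sides are values of prefixes of powers of \<open>w\<close>, which are reduced; so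
  the words agree, and lengths can be compared.\<close>

lemma prefix_mult_nat_pow:
  assumes w: "reduced (w @ w)" and ij: "i < length w" "j < length w"
    and eq: "wv w [^] (e::nat) \<otimes> wv (take i w) = wv (take j w)"
  shows "e = 0 \<and> i = j"
proof -
  have letters: "set w \<subseteq> S \<times> UNIV" "set (take i w) \<subseteq> S \<times> UNIV"
    using reduced_letters reduced_take w unfolding reduced_append_iff by blast+
  have "reduced ((word_pow w e @ take i w) @ drop i w)"
    using reduced_word_pow[OF w, of "Suc e"] by (simp only: word_pow_Suc2 append.assoc append_take_drop_id)
  then have "reduced (word_pow w e @ take i w)" "reduced (take j w)"
    using w reduced_append_iff reduced_take by blast+
  moreover have "wv (word_pow w e @ take i w) = wv (take j w)"
    using eq wv_append[OF word_pow_letters[OF letters(1)] letters(2)]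
    by (simp add: wv_word_pow[OF letters(1)])
  ultimately have "word_pow w e @ take i w = take j w"
    by (rule wv_inj)
  then have "e * length w + i = j"
    using arg_cong[of "word_pow w e @ take i w" "take j w" length] ij
    unfolding length_append length_word_pow by simp
  then show ?thesis
    using ij by (cases e) auto
qed

text \<open>A power with negative exponent is moved to the other side, which exchanges
  \<open>i\<close> and \<open>j\<close>.\<close>

lemma prefix_mult_int_pow:
  assumes w: "reduced (w @ w)" and ij: "i < length w" "j < length w"
    and eq: "wv w [^] (e::int) \<otimes> wv (take i w) = wv (take j w)"
  shows "i = j"
proof (cases e rule: int_cases2)
  case (nonneg n)
  then show ?thesis
    using eq prefix_mult_nat_pow[OF w ij, of n] by (simp only: int_pow_int)
next
  case (nonpos n)
  have letters: "set w \<subseteq> S \<times> UNIV"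
    using w unfolding reduced_append_iff by (blast intro: reduced_letters[THEN subsetD])
  note closed = wv_closed[OF letters] prefix_closed[OF letters]
  have "wv w [^] n \<otimes> wv (take j w) = wv w [^] n \<otimes> (inv (wv w [^] n) \<otimes> wv (take i w))"
    using eq closed nonpos by (simp add: int_pow_neg_int)
  also have "\<dots> = wv (take i w)"
    using closed by (simp flip: m_assoc)
  finally show ?thesis
    using prefix_mult_nat_pow[OF w ij(2,1), of n] by simp
qed

text \<open>Otherwise the quotient of the two prefixes would be a power of \<open>wv w\<close> by
  \<open>centralizer_root_power\<close>, but distinct proper prefixes lie in distinct cosets of the
  powers of \<open>wv w\<close>.\<close>

lemma prefix_quotient_not_central:
  assumes w: "root_word w" and ij: "i < length w" "j < length w" "i \<noteq> j"
  shows "wv (take i w) \<otimes> inv (wv (take j w)) \<otimes> wv w \<noteq> wv w \<otimes> (wv (take i w) \<otimes> inv (wv (take j w)))"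
proof
  have red: "reduced (w @ w)"
    using w by (simp add: root_word_def)
  have letters: "set w \<subseteq> S \<times> UNIV"
    using w by (rule root_word_letters)
  note closed = wv_closed[OF letters] prefix_closed[OF letters]
  assume "wv (take i w) \<otimes> inv (wv (take j w)) \<otimes> wv w = wv w \<otimes> (wv (take i w) \<otimes> inv (wv (take j w)))"
  then obtain e :: int where "wv (take i w) \<otimes> inv (wv (take j w)) = wv w [^] e"
    using centralizer_root_power[OF w order.refl, of "wv (take i w) \<otimes> inv (wv (take j w))"] closed by auto
  then have "wv w [^] e \<otimes> wv (take j w) = wv (take i w)"
    using closed inv_solve_right'[of "wv w [^] e" "wv (take i w)" "wv (take j w)"] by simp
  then show False
    using prefix_mult_int_pow[OF red ij(2,1)] ij(3) by simp
qed

text \<open>A shortest reduced \<open>w\<close> such that \<open>u\<close> is conjugate to a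
  positive power of its value is taken. If \<open>w\<close> were not cyclically reduced, or were a
  proper power, a shorter word would do.\<close>

lemma root_exists:
  assumes u: "u \<in> carrier G" "u \<noteq> \<one>"
  shows "\<exists>w h k. root_word w \<and> h \<in> carrier G \<and> k \<ge> (1::nat) \<and> u = h \<otimes> wv w [^] k \<otimes> inv h"
proof -
  define Q where "Q w \<longleftrightarrow> reduced w \<and> (\<exists>h k. h \<in> carrier G \<and> k \<ge> (1::nat) \<and> u = h \<otimes> wv w [^] k \<otimes> inv h)" for w
  have "Q (nf u)"
    unfolding Q_def using u by (intro conjI reduced_nf exI[of _ \<one>] exI[of _ 1]) (auto simp: wv_nf)
  then obtain w where w: "Q w" and min: "\<And>v. Q v \<Longrightarrow> length w \<le> length v"
    by (metis arg_min_nat_lemma)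
  from w have red: "reduced w"
    by (simp only: Q_def)
  from w obtain h k where hk: "h \<in> carrier G" "k \<ge> (1::nat)" "u = h \<otimes> wv w [^] k \<otimes> inv h"
    unfolding Q_def by (elim exE conjE) (rule that)
  have ne: "w \<noteq> []"
    using hk u by auto
  have letters: "set w \<subseteq> S \<times> UNIV"
    using red by (rule reduced_letters)
  have "reduced (w @ w)"
  proof (rule ccontr)
    assume "\<not> reduced (w @ w)"
    then have inv: "hd w = letter_inv (last w)"
      using red reduced_append_iff by blast
    define l v where "l = hd w" and "v = butlast (tl w)"
    \<comment> \<open>A letter differs from its inverse, so \<open>w\<close> has two distinct end
      positions, and conjugation by \<open>a\<close> strips both end letters.\<close>
    have "w \<noteq> [l]"
      using inv unfolding l_def by (metis last_ConsL list.sel(1) snd_conv)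
    then have tl: "tl w \<noteq> []"
      using ne l_def by (metis list.collapse)
    have "last (tl w) = letter_inv l"
      using tl inv ne by (simp add: l_def last_tl)
    then have w_eq: "w = [l] @ v @ [letter_inv l]"
      using ne tl unfolding l_def v_def by (metis append_Cons append_Nil append_butlast_last_id list.collapse)
    then have lv: "fst l \<in> S" "set v \<subseteq> S \<times> UNIV" "set [letter_inv l] \<subseteq> S \<times> UNIV"
      using letters by (auto simp: mem_Times_iff)
    define a where "a = letter_value G l"
    have a: "a \<in> carrier G" "wv v \<in> carrier G"
      using lv by (auto simp: a_def letter_value_closed wv_closed)
    have wv_w: "wv w = a \<otimes> wv v \<otimes> inv a"
      unfolding w_eq using lv a
      by (simp add: wv_append a_def letter_value_inv m_assoc del: letter_value.simps)
    have "Q v"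
      unfolding Q_def
    proof (intro conjI exI)
      show "reduced v"
        using red unfolding w_eq reduced_append_iff by blast
      show "h \<otimes> a \<in> carrier G" "k \<ge> 1"
        using hk a by auto
      show "u = (h \<otimes> a) \<otimes> wv v [^] k \<otimes> inv (h \<otimes> a)"
        using hk a unfolding wv_w conj_nat_pow[OF a] by (simp add: inv_mult_group m_assoc)
    qed
    then show False
      using min[of v] by (simp add: w_eq)
  qed
  moreover have "primitive_word w"
    unfolding primitive_word_def
  proof (intro conjI allI impI ne)
    fix t i
    assume t: "w = word_pow t i"
    show "i = 1"
    proof (rule ccontr)
      assume "i \<noteq> 1"
      moreover have "i \<noteq> 0" "t \<noteq> []"
        using ne t by auto
      ultimately have i: "i = Suc (i - 1)" "i \<ge> 2"
        by auto
      have red_t: "reduced t"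
        using red reduced_append_iff[of t "word_pow t (i - 1)"] t i(1) by (metis concat.simps(2) replicate_Suc)
      have wv_w: "wv w = wv t [^] i"
        unfolding t by (rule wv_word_pow[OF reduced_letters[OF red_t]])
      have "Q t"
        unfolding Q_def
      proof (intro conjI exI)
        show "reduced t" "h \<in> carrier G" by fact+
        show "i * k \<ge> 1"
          using hk i by simp
        show "u = h \<otimes> wv t [^] (i * k) \<otimes> inv h"
          using hk unfolding wv_w by (simp add: nat_pow_pow wv_closed reduced_letters[OF red_t])
      qed
      then have "i * length t \<le> length t"
        using min[of t] by (simp only: t length_word_pow)
      then show False
        using i \<open>t \<noteq> []\<close> by simp
    qed
  qed
  ultimately show ?thesis
    unfolding root_word_def using hk by blast
qed

section \<open>Translation and linearity of path sums\<close>

lemma edge_source_closed: "g \<in> carrier G \<Longrightarrow> fst l \<in> S \<Longrightarrow> edge_source g l \<in> carrier G"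
  by (simp add: basis_closed)

lemma path_sum_cong:
  assumes "\<And>h s. h \<in> carrier G \<Longrightarrow> s \<in> S \<Longrightarrow> f h s = f' h s"
    and "set w \<subseteq> S \<times> UNIV" and "g \<in> carrier G"
  shows "path_sum f g w = path_sum f' g w"
  using assms(2,3)
proof (induction w arbitrary: g)
  case (Cons l w)
  then have "fst l \<in> S" "set w \<subseteq> S \<times> UNIV"
    by (auto simp: mem_Times_iff)
  then show ?case
    using Cons assms(1)[of "edge_source g l" "fst l"]
    by (simp add: letter_value_closed basis_closed del: letter_value.simps)
qed simp

lemma path_sum_translate:
  assumes "h \<in> carrier G" and "set w \<subseteq> S \<times> UNIV" and "g \<in> carrier G"
  shows "path_sum f (h \<otimes> g) w = path_sum (\<lambda>g. f (h \<otimes> g)) g w"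
  using assms(2,3)
proof (induction w arbitrary: g)
  case (Cons l w)
  then have "fst l \<in> S" "set w \<subseteq> S \<times> UNIV"
    by (auto simp: mem_Times_iff)
  then show ?case
    using Cons assms(1) Cons.IH[of "g \<otimes> letter_value G l"]
    by (simp add: letter_value_closed basis_closed m_assoc del: letter_value.simps)
qed simp

lemma path_sum_sum:
  "path_sum (\<lambda>h s. \<Sum>i\<in>I. f i h s) g w = (\<Sum>i\<in>I. path_sum (f i) g w)"
  by (induction w arbitrary: g) (simp_all add: sum.distrib sum_distrib_left)

lemma path_sum_linear:
  "path_sum (\<lambda>h s. a * f h s + b * f' h s) g w = a * path_sum f g w + b * path_sum f' g w"
  by (induction w arbitrary: g) (simp_all add: algebra_simps)

lemma path_sum_eq_sum:
  "set w \<subseteq> S \<times> UNIV \<Longrightarrow> g \<in> carrier G \<Longrightarrow>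
   path_sum f g w =
     (\<Sum>i<length w. letter_sign (w ! i) * f (edge_source (g \<otimes> wv (take i w)) (w ! i)) (fst (w ! i)))"
proof (induction w arbitrary: g)
  case (Cons l w)
  then have l: "fst l \<in> S" and w: "set w \<subseteq> S \<times> UNIV" and g': "g \<otimes> letter_value G l \<in> carrier G"
    by (auto simp: mem_Times_iff letter_value_closed simp del: letter_value.simps)
  have "g \<otimes> letter_value G l \<otimes> wv (take i w) = g \<otimes> (letter_value G l \<otimes> wv (take i w))" for i
    using Cons.prems l prefix_closed[OF w] by (simp add: m_assoc letter_value_closed del: letter_value.simps)
  then show ?case
    using Cons.IH[OF w g'] Cons.prems(2)
    by (simp add: sum.lessThan_Suc_shift cong: if_cong del: letter_value.simps sum.lessThan_Suc)
qed simp

lemma flow_sum: "flow (\<lambda>h s. \<Sum>i\<in>I. f i h s) x g = (\<Sum>i\<in>I. flow (f i) x g)"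
  unfolding flow_def by (rule path_sum_sum)

lemma flow_linear: "flow (\<lambda>h s. a * f h s + b * f' h s) x g = a * flow f x g + b * flow f' x g"
  unfolding flow_def by (rule path_sum_linear)

lemma flow_translate:
  "h \<in> carrier G \<Longrightarrow> x \<in> carrier G \<Longrightarrow> g \<in> carrier G \<Longrightarrow>
   flow f x (h \<otimes> g) = flow (\<lambda>g. f (h \<otimes> g)) x g"
  unfolding flow_def by (rule path_sum_translate) (auto dest: nf_letters)

lemma flow_cong:
  assumes "\<And>h s. h \<in> carrier G \<Longrightarrow> s \<in> S \<Longrightarrow> f h s = f' h s"
    and "x \<in> carrier G" and "g \<in> carrier G"
  shows "flow f x g = flow f' x g"
  unfolding flow_def using assms nf_letters by (intro path_sum_cong) auto

section \<open>Weights that descend to the Cayley graph of the quotient by a normal subgroup\<close>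

definition coset_invariant :: "'a set \<Rightarrow> ('a \<Rightarrow> 'a \<Rightarrow> int) \<Rightarrow> bool" where
  "coset_invariant N f \<longleftrightarrow>
     (\<forall>g \<in> carrier G. \<forall>h \<in> carrier G. \<forall>s \<in> S. N #> g = N #> h \<longrightarrow> f g s = f h s)"

text \<open>The path from \<open>g\<close> is the left translate of the path from \<open>h\<close>
  by an element of \<open>N\<close>, and such translations preserve the weight.\<close>

lemma flow_coset_invariant:
  assumes N: "N \<lhd> G" and f: "coset_invariant N f"
    and x: "x \<in> carrier G" and g: "g \<in> carrier G" "h \<in> carrier G" and eq: "N #> g = N #> h"
  shows "flow f x g = flow f x h"
proof -
  define n where "n = g \<otimes> inv h"
  have n: "n \<in> N" "n \<in> carrier G"
    using eq g coset_eq_iff[OF N] by (auto simp: n_def)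
  have n_eq: "N #> n = N #> \<one>"
    using coset_eq_one_iff[OF N n(2)] n(1) by blast
  have "f (n \<otimes> k) s = f k s" if "k \<in> carrier G" "s \<in> S" for k s
  proof -
    have "N #> (n \<otimes> k) = N #> (\<one> \<otimes> k)"
      using coset_mult_right_iff[OF N n(2) one_closed that(1)] n_eq by blast
    then show ?thesis
      using f that n(2) unfolding coset_invariant_def by (metis l_one m_closed)
  qed
  then have "flow (\<lambda>k. f (n \<otimes> k)) x h = flow f x h"
    using x g(2) by (rule flow_cong)
  moreover have "g = n \<otimes> h"
    using g by (simp add: n_def m_assoc)
  ultimately show ?thesis
    using flow_translate[OF n(2) x g(2)] by simp
qed

text \<open>An element of \<open>N\<close> labels a closed path modulo \<open>N\<close>, so the path
  of \<open>y\<close> starts again at the coset of \<open>g\<close>. Thus the flow from a fixed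
  vertex is a homomorphism on \<open>N\<close>.\<close>

lemma flow_mult_normal:
  assumes N: "N \<lhd> G" and f: "coset_invariant N f"
    and x: "x \<in> N" and y: "y \<in> carrier G" and g: "g \<in> carrier G"
  shows "flow f (x \<otimes> y) g = flow f x g + flow f y g"
proof -
  have x': "x \<in> carrier G"
    using normal_mem_carrier[OF N x] .
  then show ?thesis
    using flow_mult[OF x' y g] flow_coset_invariant[OF N f y _ g coset_mult_normal[OF N x g]] g by simp
qed

lemma flow_pow_normal:
  assumes N: "N \<lhd> G" and f: "coset_invariant N f" and x: "x \<in> N" and g: "g \<in> carrier G"
  shows "flow f (x [^] (n::nat)) g = int n * flow f x g"
proof (induction n)
  case (Suc n)
  have x': "x \<in> carrier G"
    using normal_mem_carrier[OF N x] .
  have "x [^] Suc n = x \<otimes> x [^] n"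
    using nat_pow_Suc2[OF x'] .
  then show ?case
    using flow_mult_normal[OF N f x _ g, of "x [^] n"] x' Suc by (simp add: algebra_simps)
qed (simp add: flow_one g)

text \<open>The way out along \<open>y\<close> and the way back cancel, because the loop of
  \<open>x\<close> between them is closed modulo \<open>N\<close>.\<close>

lemma flow_conj_normal:
  assumes N: "N \<lhd> G" and f: "coset_invariant N f"
    and x: "x \<in> N" and y: "y \<in> carrier G" and g: "g \<in> carrier G"
  shows "flow f (y \<otimes> x \<otimes> inv y) g = flow f x (g \<otimes> y)"
proof -
  have x': "x \<in> carrier G"
    using normal_mem_carrier[OF N x] .
  have "y \<otimes> x \<otimes> inv y = y \<otimes> (x \<otimes> inv y)"
    using x' y by (simp add: m_assoc)
  then have "flow f (y \<otimes> x \<otimes> inv y) g = flow f y g + (flow f x (g \<otimes> y) + flow f (inv y) (g \<otimes> y))"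
    using flow_mult[OF y _ g] flow_mult_normal[OF N f x] x' y g by simp
  then show ?thesis
    using y g by (simp add: flow_inv m_assoc)
qed

text \<open>All starting vertices are included because conjugation moves the starting vertex; this
  makes the set normal.\<close>

definition flow_kernel :: "'a set \<Rightarrow> ('a \<Rightarrow> 'a \<Rightarrow> int) \<Rightarrow> nat \<Rightarrow> 'a set" where
  "flow_kernel N f m = {x \<in> N. \<forall>g \<in> carrier G. int m dvd flow f x g}"

lemma flow_kernel_normal:
  assumes N: "N \<lhd> G" and f: "coset_invariant N f"
  shows "flow_kernel N f m \<lhd> G"
proof -
  have sub: "subgroup N G"
    using N by (rule normal_imp_subgroup)
  have carr: "x \<in> carrier G" if "x \<in> N" for x
    using normal_mem_carrier[OF N that] .
  have "subgroup (flow_kernel N f m) G"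
  proof (rule subgroupI)
    show "flow_kernel N f m \<subseteq> carrier G"
      using carr by (auto simp: flow_kernel_def)
    have "\<one> \<in> flow_kernel N f m"
      using sub by (simp add: flow_kernel_def flow_one subgroup.one_closed)
    then show "flow_kernel N f m \<noteq> {}"
      by blast
  next
    fix x assume "x \<in> flow_kernel N f m"
    then show "inv x \<in> flow_kernel N f m"
      using sub carr by (auto simp: flow_kernel_def flow_inv subgroup.m_inv_closed)
  next
    fix x y assume "x \<in> flow_kernel N f m" "y \<in> flow_kernel N f m"
    then show "x \<otimes> y \<in> flow_kernel N f m"
      using sub carr by (auto simp: flow_kernel_def flow_mult_normal[OF N f] subgroup.m_closed)
  qed
  moreover have "y \<otimes> x \<otimes> inv y \<in> flow_kernel N f m"
    if "y \<in> carrier G" "x \<in> flow_kernel N f m" for x y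
    using that normal.inv_op_closed2[OF N] by (auto simp: flow_kernel_def flow_conj_normal[OF N f])
  ultimately show ?thesis
    unfolding normal_inv_iff by blast
qed

text \<open>The coset of \<open>x\<close> is determined by its coset modulo \<open>N\<close>
  together with the residues modulo \<open>m\<close> of its flow from one representative of each
  coset of \<open>N\<close>.\<close>

lemma flow_kernel_finite_rcosets:
  assumes N: "N \<lhd> G" and fin: "finite (rcosets N)" and f: "coset_invariant N f" and m: "m > 0"
  shows "finite (rcosets (flow_kernel N f m))"
proof -
  define r where "r C = (SOME h. h \<in> carrier G \<and> N #> h = C)" for C
  have r: "r (N #> g) \<in> carrier G" "N #> r (N #> g) = N #> g" if "g \<in> carrier G" for g
    using someI[of "\<lambda>h. h \<in> carrier G \<and> N #> h = N #> g" g] that unfolding r_def by auto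
  define F where "F x = (N #> x, \<lambda>C\<in>rcosets N. flow f x (r C) mod int m)" for x
  have coset: "N #> x \<in> rcosets N" if "x \<in> carrier G" for x
    using that by (rule coset_in_rcosets[OF N])
  show ?thesis
  proof (rule finite_rcosetsI[where F = F])
    have "F ` carrier G \<subseteq> (rcosets N) \<times> ((rcosets N) \<rightarrow>\<^sub>E {0..<int m})"
      using m coset by (auto simp: F_def)
    moreover have "finite ((rcosets N) \<times> ((rcosets N) \<rightarrow>\<^sub>E {0..<int m}))"
      using fin by (intro finite_cartesian_product finite_PiE) auto
    ultimately show "finite (F ` carrier G)"
      by (rule finite_subset)
  next
    fix x y
    assume x: "x \<in> carrier G" and y: "y \<in> carrier G" and eq: "F x = F y"
    then have xy: "x \<otimes> inv y \<in> N"
      using coset_eq_iff[OF N] by (simp add: F_def)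
    have "int m dvd flow f (x \<otimes> inv y) g" if g: "g \<in> carrier G" for g
    proof -
      have "flow f x (r (N #> g)) mod int m = flow f y (r (N #> g)) mod int m"
        using eq coset[OF g] unfolding F_def by (auto dest!: fun_cong[of _ _ "N #> g"])
      then have "flow f x g mod int m = flow f y g mod int m"
        using flow_coset_invariant[OF N f _ r(1)[OF g] g r(2)[OF g]] x y by simp
      moreover have "flow f (x \<otimes> inv y) g = flow f x g - flow f y g"
      proof -
        have "flow f (x \<otimes> inv y) g = flow f x g - flow f y (g \<otimes> (x \<otimes> inv y))"
          using x y g by (simp add: flow_mult flow_inv m_assoc)
        then show ?thesis
          using flow_coset_invariant[OF N f y _ g coset_mult_normal[OF N xy g]] x y g by simp
      qed
      ultimately show ?thesis
        by (simp add: mod_eq_dvd_iff)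
    qed
    then show "x \<otimes> inv y \<in> flow_kernel N f m"
      using xy by (simp add: flow_kernel_def)
  qed (rule flow_kernel_normal[OF N f])
qed

text \<open>Modulo \<open>N\<close> the path meets its first edge only once, so only that edge
  contributes. The vertices before the last are required to be distinct; the last may coincide with
  the first, so simple loops are covered.\<close>

lemma flow_first_edge:
  assumes N: "N \<lhd> G" and w: "reduced (l # w)" and g: "g \<in> carrier G"
    and simple: "\<And>i j. i < j \<Longrightarrow> j < length (l # w) \<Longrightarrow>
      N #> wv (take i (l # w)) \<noteq> N #> wv (take j (l # w))"
    and supp: "\<And>h s. h \<in> carrier G \<Longrightarrow> s \<in> S \<Longrightarrow> f h s \<noteq> 0 \<Longrightarrow>
      s = fst l \<and> N #> h = N #> edge_source g l"
  shows "flow f (wv (l # w)) g = letter_sign l * f (edge_source g l) (fst l)"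
proof -
  define v where "v i = wv (take i (l # w))" for i
  have letters: "set (l # w) \<subseteq> S \<times> UNIV"
    using w by (rule reduced_letters)
  then have l: "fst l \<in> S"
    by (auto simp: mem_Times_iff)
  have v: "v i \<in> carrier G" for i
    unfolding v_def by (rule prefix_closed[OF letters])
  have v0: "v 0 = \<one>" and v1: "v 1 = letter_value G l"
    using l by (simp_all add: v_def letter_value_closed del: letter_value.simps)
  have "f (edge_source (g \<otimes> v i) m) (fst m) = 0"
    if i: "i > 0" "i < length (l # w)" and m: "m = (l # w) ! i" for i m
  proof (rule ccontr)
    assume nz: "f (edge_source (g \<otimes> v i) m) (fst m) \<noteq> 0"
    have mS: "fst m \<in> S"
      using subsetD[OF letters nth_mem[OF i(2)]] unfolding m by (simp only: mem_Times_iff)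
    have eq: "fst m = fst l" "N #> edge_source (g \<otimes> v i) m = N #> edge_source g l"
      using supp[OF _ mS nz] edge_source_closed mS v g by auto
    have s: "fst l \<in> carrier G"
      using l by (rule basis_closed)
    show False
    proof (cases "snd m = snd l")
      case True
      have "N #> (g \<otimes> v i) = N #> (g \<otimes> v 0)"
        using eq True g v s coset_mult_right_iff[OF N _ g, of "g \<otimes> v i" "inv (fst l)"] v0
        by (auto split: if_splits)
      then show False
        using coset_mult_left_iff[OF N v v g] simple[OF i] unfolding v_def[symmetric] by metis
    next
      case False
      \<comment> \<open>A traversal in the opposite direction starts where the first edge ends.
        Distinctness forces \<open>i = 1\<close>, and then the second letter would cancel the
        first.\<close>
      have "N #> (g \<otimes> v i) = N #> (g \<otimes> v 1)"
      proof (cases "snd l")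
        case True
        then have "N #> (g \<otimes> v i \<otimes> inv (fst l)) = N #> (g \<otimes> fst l \<otimes> inv (fst l))"
          using eq \<open>snd m \<noteq> snd l\<close> g s by (simp add: m_assoc)
        moreover have "v 1 = fst l"
          unfolding v1 using True by (cases l) simp
        ultimately show ?thesis
          using coset_mult_right_iff[OF N] g v s by auto
      next
        case f: False
        moreover have "v 1 = inv (fst l)"
          unfolding v1 using f by (cases l) simp
        ultimately show ?thesis
          using eq \<open>snd m \<noteq> snd l\<close> by simp
      qed
      then have "N #> v i = N #> v 1"
        using coset_mult_left_iff[OF N v v g] by blast
      then have "i = 1"
        using simple[of 1 i] i unfolding v_def by (cases "i = 1") auto
      moreover have "m = letter_inv l"
        using eq(1) False by (simp add: prod_eq_iff)
      ultimately show False
        using w i m unfolding reduced_iff by (cases w) auto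
    qed
  qed
  then have "(\<Sum>i<length (l # w). letter_sign ((l # w) ! i) *
        f (edge_source (g \<otimes> v i) ((l # w) ! i)) (fst ((l # w) ! i)))
      = (\<Sum>i\<in>{0}. letter_sign ((l # w) ! i) *
        f (edge_source (g \<otimes> v i) ((l # w) ! i)) (fst ((l # w) ! i)))"
    by (intro sum.mono_neutral_right) auto
  then show ?thesis
    using flow_wv[OF letters g] path_sum_eq_sum[OF letters g] v0 g unfolding v_def by simp
qed

definition edge_indicator :: "'a set \<Rightarrow> 'a \<Rightarrow> 'a \<times> bool \<Rightarrow> 'a \<Rightarrow> 'a \<Rightarrow> int" where
  "edge_indicator N g l h s = of_bool (s = fst l \<and> N #> h = N #> edge_source g l)"

lemma edge_indicator_invariant: "coset_invariant N (edge_indicator N g l)"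
  by (simp add: coset_invariant_def edge_indicator_def)

lemma flow_edge_indicator:
  assumes "N \<lhd> G" and "reduced (l # w)" and "g \<in> carrier G"
    and "\<And>i j. i < j \<Longrightarrow> j < length (l # w) \<Longrightarrow>
      N #> wv (take i (l # w)) \<noteq> N #> wv (take j (l # w))"
  shows "flow (edge_indicator N g l) (wv (l # w)) g = letter_sign l"
proof -
  have "flow (edge_indicator N g l) (wv (l # w)) g
      = letter_sign l * edge_indicator N g l (edge_source g l) (fst l)"
    by (rule flow_first_edge[OF assms]) (auto simp: edge_indicator_def split: if_splits)
  then show ?thesis
    by (simp add: edge_indicator_def)
qed

end

section \<open>Chains of normal subgroups and residual \<open>p\<close>-finiteness\<close>

locale based_free_group_prime = based_free_group G S for G (structure) and S +
  fixes p :: nat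
  assumes prime: "prime p"
begin

text \<open>The quotients of \<open>G\<close> by these subgroups are finite \<open>p\<close>-groups.
  The chain is part of the notion because at each step the order of an element modulo the subgroup
  changes by a factor 1 or \<open>p\<close>.\<close>

inductive tower :: "'a set \<Rightarrow> bool" where
  top: "tower (carrier G)"
| step: "tower M \<Longrightarrow> N \<lhd> G \<Longrightarrow> N \<subseteq> M \<Longrightarrow> finite (rcosets N) \<Longrightarrow>
    (\<And>x. x \<in> M \<Longrightarrow> x [^] p \<in> N) \<Longrightarrow> tower N"

lemma tower_normal: "tower N \<Longrightarrow> N \<lhd> G"
  by (cases rule: tower.cases) (auto intro: carrier_normal)

lemma tower_finite: "tower N \<Longrightarrow> finite (rcosets N)"
proof (induction rule: tower.induct)
  case top
  show ?case
    by (rule finite_rcosetsI[where F = "\<lambda>x. ()"]) (auto simp: carrier_normal)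
qed

text \<open>Intersecting the chain of \<open>N\<close> with \<open>M\<close> gives a chain that
  starts at \<open>M\<close> and continues that of \<open>M\<close>.\<close>

lemma tower_Int: "tower N \<Longrightarrow> tower M \<Longrightarrow> tower (M \<inter> N)"
proof (induction rule: tower.induct)
  case top
  then have "M \<inter> carrier G = M"
    using normal_mem_carrier[OF tower_normal] by blast
  then show ?case
    using top by simp
next
  case (step N N')
  have M: "M \<lhd> G" "finite (rcosets M)"
    using step.prems tower_normal tower_finite by auto
  show ?case
  proof (rule tower.step)
    show "tower (M \<inter> N)"
      using step by blast
    show "M \<inter> N' \<lhd> G"
      using M step normal_subgroup_intersect by blast
    show "finite (rcosets (M \<inter> N'))"
      using M step finite_rcosets_Int by blast
    show "M \<inter> N' \<subseteq> M \<inter> N"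
      using step by blast
    show "x [^] p \<in> M \<inter> N'" if "x \<in> M \<inter> N" for x
      using that step.hyps subgroup_nat_pow_closed[OF normal_imp_subgroup[OF M(1)]] by blast
  qed
qed

text \<open>Raising to the power \<open>p\<close> multiplies flows on \<open>N\<close> by
  \<open>p\<close>, so the kernels for increasing \<open>k\<close> form a chain.\<close>

lemma tower_flow_kernel:
  assumes "tower N" and f: "coset_invariant N f"
  shows "tower (flow_kernel N f (p ^ k))"
proof (induction k)
  case 0
  have "flow_kernel N f 1 = N"
    by (auto simp: flow_kernel_def)
  then show ?case
    using assms by simp
next
  case (Suc k)
  have N: "N \<lhd> G"
    using assms tower_normal by blast
  show ?case
  proof (rule tower.step[OF Suc])
    show "flow_kernel N f (p ^ Suc k) \<lhd> G"
      by (rule flow_kernel_normal[OF N f])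
    show "finite (rcosets flow_kernel N f (p ^ Suc k))"
      using flow_kernel_finite_rcosets[OF N tower_finite[OF assms(1)] f] prime prime_gt_0_nat by simp
    show "flow_kernel N f (p ^ Suc k) \<subseteq> flow_kernel N f (p ^ k)"
      by (auto simp: flow_kernel_def intro: dvd_mult_right)
    show "x [^] p \<in> flow_kernel N f (p ^ Suc k)" if "x \<in> flow_kernel N f (p ^ k)" for x
      using that normal_imp_subgroup[OF N]
      by (auto simp: flow_kernel_def flow_pow_normal[OF N f] mult_dvd_mono subgroup_nat_pow_closed)
  qed
qed

lemma tower_avoids_finite:
  assumes "finite X" and "\<And>x. x \<in> X \<Longrightarrow> \<exists>N. tower N \<and> x \<notin> N"
  shows "\<exists>N. tower N \<and> X \<inter> N = {}"
  using assms
proof (induction X rule: finite_induct)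
  case empty
  then show ?case
    using tower.top by blast
next
  case (insert x X)
  then obtain M N where "tower M" "X \<inter> M = {}" "tower N" "x \<notin> N"
    by (metis insertI1 insertI2)
  then show ?case
    using tower_Int by (intro exI[of _ "M \<inter> N"]) auto
qed

text \<open>By induction some \<open>N\<close> avoids all shorter subwords, which makes the path of
  \<open>w\<close> simple modulo \<open>N\<close> up to its end. The indicator of its first edge
  then has flow 1 or -1 along \<open>w\<close>, and the flow kernel modulo \<open>p\<close> misses
  \<open>wv w\<close>.\<close>

lemma tower_avoids_word:
  "reduced w \<Longrightarrow> w \<noteq> [] \<Longrightarrow> \<exists>N. tower N \<and> wv w \<notin> N"
proof (induction "length w" arbitrary: w rule: less_induct)
  case less
  \<comment> \<open>Since \<open>j < length w\<close>, all the subwords are proper and induction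
    applies. The final vertex stays unrestricted, as \<open>flow_edge_indicator\<close>
    permits.\<close>
  define I where "I = {(i, j). i < j \<and> j < length w}"
  define u where "u = (\<lambda>(i, j). drop i (take j w))"
  have letters: "set w \<subseteq> S \<times> UNIV"
    using less.prems reduced_letters by blast
  have "finite I"
    by (rule finite_subset[of _ "{..<length w} \<times> {..<length w}"]) (auto simp: I_def)
  moreover have "\<exists>N. tower N \<and> wv (u ij) \<notin> N" if "ij \<in> I" for ij
  proof (rule less.hyps)
    show "length (u ij) < length w" "u ij \<noteq> []"
      using that by (auto simp: I_def u_def)
    have "reduced (take (fst ij) (take (snd ij) w) @ u ij)"
      unfolding u_def case_prod_unfold append_take_drop_id using less.prems by (simp add: reduced_take)
    then show "reduced (u ij)"
      using reduced_append_iff by blast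
  qed
  ultimately have "\<exists>N. tower N \<and> (\<lambda>ij. wv (u ij)) ` I \<inter> N = {}"
    by (intro tower_avoids_finite) auto
  then obtain N where N: "tower N" "(\<lambda>ij. wv (u ij)) ` I \<inter> N = {}"
    by blast
  have normal: "N \<lhd> G"
    using N(1) by (rule tower_normal)
  have simple: "N #> wv (take i w) \<noteq> N #> wv (take j w)" if ij: "i < j" "j < length w" for i j
  proof
    assume eq: "N #> wv (take i w) = N #> wv (take j w)"
    have u: "set (u (i, j)) \<subseteq> S \<times> UNIV"
      using letters set_drop_subset set_take_subset unfolding u_def by fastforce
    have "take j w = take i w @ u (i, j)"
      using ij unfolding u_def by (metis append_take_drop_id case_prod_conv min.absorb1 nat_less_le take_take)
    then have "wv (take j w) = wv (take i w) \<otimes> wv (u (i, j))"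
      using letters u by (metis set_take_subset subset_trans wv_append)
    then have "N #> (wv (take i w) \<otimes> \<one>) = N #> (wv (take i w) \<otimes> wv (u (i, j)))"
      using eq prefix_closed[OF letters] by simp
    then have "N #> wv (u (i, j)) = N #> \<one>"
      using coset_mult_left_iff[OF normal one_closed wv_closed[OF u] prefix_closed[OF letters]]
      by metis
    then have "wv (u (i, j)) \<in> N"
      using coset_eq_one_iff[OF normal] wv_closed[OF u] by blast
    moreover have "(i, j) \<in> I"
      using ij by (simp add: I_def)
    ultimately show False
      using N(2) by blast
  qed
  obtain l v where w: "w = l # v"
    using less.prems by (cases w) auto
  have "flow (edge_indicator N \<one> l) (wv w) \<one> = letter_sign l"
    unfolding w using less.prems simple normal
    by (intro flow_edge_indicator) (simp_all add: w)
  then have "\<not> int p dvd flow (edge_indicator N \<one> l) (wv w) \<one>"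
    using prime by (auto dest: prime_gt_1_nat)
  then have "wv w \<notin> flow_kernel N (edge_indicator N \<one> l) (p ^ 1)"
    by (auto simp: flow_kernel_def)
  then show ?case
    using tower_flow_kernel[OF N(1) edge_indicator_invariant] by blast
qed

lemma tower_avoids: "x \<in> carrier G \<Longrightarrow> x \<noteq> \<one> \<Longrightarrow> \<exists>N. tower N \<and> x \<notin> N"
  using tower_avoids_word[of "nf x"] reduced_nf wv_nf by force

end

section \<open>Loops of root words in a quotient graph\<close>

context based_free_group
begin

text \<open>By \<open>coset_int_pow_commutes\<close>, this finite list of inequalities keeps
  distinct proper prefixes in distinct cosets of the powers of \<open>wv w\<close>, even modulo
  \<open>N\<close>.\<close>

abbreviation separates_root :: "'a set \<Rightarrow> 'a gword \<Rightarrow> bool" where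
  "separates_root N w \<equiv> (\<forall>i < length w. \<forall>j < length w. i \<noteq> j \<longrightarrow>
     N #> (wv (take i w) \<otimes> inv (wv (take j w)) \<otimes> wv w) \<noteq>
     N #> (wv w \<otimes> (wv (take i w) \<otimes> inv (wv (take j w)))))"

text \<open>A vertex is a power of \<open>wv w\<close> times a proper prefix. Equal vertices have
  equal prefixes by \<open>sep\<close>, and then the powers differ by an exponent that is a multiple
  of the period but smaller than it.\<close>

lemma loop_vertices_distinct:
  assumes N: "N \<lhd> G" and w: "root_word w" and sep: "separates_root N w"
    and ij: "i < j" "j < period N (wv w) * length w"
  shows "N #> wv (take i (word_pow w (period N (wv w)))) \<noteq>
    N #> wv (take j (word_pow w (period N (wv w))))"
proof
  define x a len where "x = wv w" and "a = period N x" and "len = length w"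
  have letters: "set w \<subseteq> S \<times> UNIV"
    using w by (rule root_word_letters)
  have x: "x \<in> carrier G"
    unfolding x_def by (rule wv_closed[OF letters])
  note pre = prefix_closed[OF letters]
  have len: "len > 0"
    using root_word_nonempty[OF w] by (simp add: len_def)
  have val: "wv (take k (word_pow w a)) = x [^] (k div len) \<otimes> wv (take (k mod len) w)"
    if "k < a * length w" for k
    unfolding take_word_pow[OF that] len_def x_def
    using letters set_take_subset[of "k mod length w" w]
    by (subst wv_append) (auto simp only: word_pow_letters wv_word_pow)
  assume "N #> wv (take i (word_pow w (period N (wv w)))) = N #> wv (take j (word_pow w (period N (wv w))))"
  then have eq: "N #> (x [^] (i div len) \<otimes> wv (take (i mod len) w)) =
      N #> (x [^] (j div len) \<otimes> wv (take (j mod len) w))"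
    using val ij unfolding a_def x_def by simp
  then have "N #> (wv (take (i mod len) w) \<otimes> inv (wv (take (j mod len) w))) =
      N #> (x [^] (int (j div len) - int (i div len)))"
    by (rule coset_solve_pow[OF N x pre pre])
  then have "N #> (wv (take (i mod len) w) \<otimes> inv (wv (take (j mod len) w)) \<otimes> x) =
      N #> (x \<otimes> (wv (take (i mod len) w) \<otimes> inv (wv (take (j mod len) w))))"
    by (intro coset_int_pow_commutes[OF N x]) (use pre in auto)
  then have mod_eq: "i mod len = j mod len"
    using sep len unfolding x_def len_def by (metis mod_less_divisor)
  then have le: "i div len < j div len"
    using ij(1) div_mult_mod_eq[of i len] div_mult_mod_eq[of j len]
    by (metis add_less_cancel_right mult_less_cancel2)
  have "N #> (x [^] (i div len)) = N #> (x [^] (j div len))"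
    using eq mod_eq coset_mult_right_iff[OF N _ _ pre] x by simp
  then have "N #> (x [^] (i div len) \<otimes> \<one>) = N #> (x [^] (i div len) \<otimes> x [^] (j div len - i div len))"
    using le x by (simp add: nat_pow_mult)
  then have "N #> \<one> = N #> (x [^] (j div len - i div len))"
    using coset_mult_left_iff[OF N, of \<one> "x [^] (j div len - i div len)" "x [^] (i div len)"] x by simp
  then have "x [^] (j div len - i div len) \<in> N"
    using coset_eq_one_iff[OF N, of "x [^] (j div len - i div len)"] x by simp
  then have "a dvd j div len - i div len"
    using pow_mem_normal_iff[OF N x] a_def by simp
  then have "a \<le> j div len - i div len"
    using le by (intro dvd_imp_le) auto
  moreover have "j div len < a"
    using ij(2) len unfolding a_def x_def len_def by (simp add: less_mult_imp_div_less)
  ultimately show False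
    by simp
qed

lemma loop_first_edge:
  assumes N: "N \<lhd> G" and w: "root_word w" and sep: "separates_root N w"
    and a: "period N (wv w) > 0" and g: "g \<in> carrier G"
    and supp: "\<And>h s. h \<in> carrier G \<Longrightarrow> s \<in> S \<Longrightarrow> f h s \<noteq> 0 \<Longrightarrow>
      s = fst (hd w) \<and> N #> h = N #> edge_source g (hd w)"
  shows "flow f (wv w [^] period N (wv w)) g = letter_sign (hd w) * f (edge_source g (hd w)) (fst (hd w))"
proof -
  define W where "W = word_pow w (period N (wv w))"
  have "W \<noteq> []" and hd: "hd W = hd w"
    using a root_word_nonempty[OF w] unfolding W_def by (cases "period N (wv w)"; simp)+
  then have W: "hd w # tl W = W"
    by (metis list.collapse)
  have "length W = period N (wv w) * length w"
    unfolding W_def by (rule length_word_pow)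
  moreover have "reduced W"
    unfolding W_def using w by (intro reduced_word_pow) (simp add: root_word_def)
  ultimately have "flow f (wv (hd w # tl W)) g = letter_sign (hd w) * f (edge_source g (hd w)) (fst (hd w))"
    using loop_vertices_distinct[OF N w sep] unfolding W_def[symmetric]
    by (intro flow_first_edge[OF N _ g _ supp]) (simp_all add: W)
  then show ?thesis
    unfolding W by (simp only: W_def wv_word_pow[OF root_word_letters[OF w]])
qed

text \<open>A nonzero flow means that the path runs through the edge, so \<open>h\<close>, being one
  of its endpoints, is a vertex of the path modulo \<open>N\<close>.\<close>

lemma loop_edge_vertex:
  assumes N: "N \<lhd> G" and w: "root_word w" and h: "h \<in> carrier G" and l: "fst l \<in> S"
    and nz: "flow (edge_indicator N h l) (wv w [^] (a::nat)) \<one> \<noteq> 0"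
  shows "\<exists>q r. r < length w \<and> N #> h = N #> (wv w [^] (q::nat) \<otimes> wv (take r w))"
proof -
  define W where "W = word_pow w a"
  have letters: "set w \<subseteq> S \<times> UNIV" "set W \<subseteq> S \<times> UNIV"
    using root_word_letters[OF w] word_pow_letters unfolding W_def by blast+
  have x: "wv w \<in> carrier G"
    using w by (rule root_word_closed)
  have len: "length w > 0"
    using root_word_nonempty[OF w] by simp
  have lenW: "length W = a * length w"
    unfolding W_def by (rule length_word_pow)
  \<comment> \<open>The end of the path is included, since the vertex after the last letter is
    needed below.\<close>
  have vertex: "\<exists>q r. r < length w \<and> wv (take i W) = wv w [^] (q::nat) \<otimes> wv (take r w)"
    if i: "i \<le> length W" for i
  proof (cases "i = length W")
    case True
    then have "wv (take i W) = wv w [^] a \<otimes> wv (take 0 w)"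
      using x wv_word_pow[OF letters(1), of a] by (simp add: W_def)
    then show ?thesis
      using len by blast
  next
    case False
    then have "i < a * length w"
      using i lenW by simp
    then have "take i W = word_pow w (i div length w) @ take (i mod length w) w"
      unfolding W_def by (rule take_word_pow)
    moreover have "set (take (i mod length w) w) \<subseteq> S \<times> UNIV"
      using letters(1) set_take_subset by (rule subset_trans[rotated])
    ultimately have "wv (take i W) = wv w [^] (i div length w) \<otimes> wv (take (i mod length w) w)"
      using wv_append[OF word_pow_letters[OF letters(1)]] wv_word_pow[OF letters(1)] by simp
    then show ?thesis
      using len mod_less_divisor by blast
  qed
  have "flow (edge_indicator N h l) (wv w [^] a) \<one> = path_sum (edge_indicator N h l) \<one> W"
    using flow_wv[OF letters(2) one_closed] wv_word_pow[OF letters(1), of a] by (simp add: W_def)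
  moreover have "path_sum (edge_indicator N h l) \<one> W = 0"
    if "\<forall>i < length W. edge_indicator N h l (edge_source (\<one> \<otimes> wv (take i W)) (W ! i)) (fst (W ! i)) = 0"
    unfolding path_sum_eq_sum[OF letters(2) one_closed] using that by (intro sum.neutral) simp
  ultimately have "\<not> (\<forall>i < length W. edge_indicator N h l (edge_source (\<one> \<otimes> wv (take i W)) (W ! i)) (fst (W ! i)) = 0)"
    using nz by argo
  then obtain i where i: "i < length W"
    and ind: "edge_indicator N h l (edge_source (\<one> \<otimes> wv (take i W)) (W ! i)) (fst (W ! i)) \<noteq> 0"
    by blast
  define m v where "m = W ! i" and "v = wv (take i W)"
  have v: "v \<in> carrier G"
    unfolding v_def by (rule prefix_closed[OF letters(2)])
  have s: "fst l \<in> carrier G"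
    using l by (rule basis_closed)
  have ml: "fst m = fst l" and src: "N #> edge_source v m = N #> edge_source h l"
    using ind unfolding edge_indicator_def of_bool_eq_0_iff not_not
      m_def[symmetric] v_def[symmetric] l_one[OF v] by blast+
  have "take (Suc i) W = take i W @ [m]"
    unfolding m_def using i by (rule take_Suc_conv_app_nth)
  moreover have "set (take i W) \<subseteq> S \<times> UNIV" "set [m] \<subseteq> S \<times> UNIV"
    using letters(2) set_take_subset[of i W] ml l by (auto simp: mem_Times_iff)
  ultimately have next_v: "wv (take (Suc i) W) = v \<otimes> letter_value G m"
    using ml l by (simp add: wv_append v_def letter_value_closed del: letter_value.simps)
  \<comment> \<open>The edge is left from \<open>h\<close> by \<open>l\<close>. A crossing in the
    same direction starts at \<open>h\<close>; one in the opposite direction ends there.\<close>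
  have "N #> h = N #> wv (take i W) \<or> N #> h = N #> wv (take (Suc i) W)"
  proof (cases "snd m = snd l")
    case True
    then have "N #> v = N #> h"
      using src ml coset_mult_right_iff[OF N v h, of "inv (fst l)"] s by (simp split: if_splits)
    then show ?thesis
      unfolding v_def by simp
  next
    case False
    show ?thesis
    proof (cases "snd l")
      case True
      then have "letter_value G m = inv (fst l)"
        using False ml by (cases m) simp
      then show ?thesis
        using src True False ml next_v by simp
    next
      case f: False
      then have "letter_value G m = fst l"
        using False ml by (cases m) simp
      moreover have "N #> (v \<otimes> fst l) = N #> (h \<otimes> inv (fst l) \<otimes> fst l)"
        using src f False ml coset_mult_right_iff[OF N v, of "h \<otimes> inv (fst l)" "fst l"] s h by simp
      ultimately show ?thesis
        using next_v h s by (simp add: m_assoc)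
    qed
  qed
  then show ?thesis
    using vertex[of i] vertex[of "Suc i"] i by (metis Suc_leI less_imp_le)
qed

section \<open>Weights that separate the loops of two root words\<close>

lemma coset_invariant_linear:
  "coset_invariant N f \<Longrightarrow> coset_invariant N f' \<Longrightarrow> coset_invariant N (\<lambda>h s. a * f h s + b * f' h s)"
  unfolding coset_invariant_def by (metis (no_types, lifting))

text \<open>Modulo \<open>N\<close>, no conjugate of a small power of \<open>y\<close> by a prefix
  of \<open>w\<close> is a power of \<open>wv w\<close>. The bound on \<open>d\<close> suffices for
  a pigeonhole argument on the positions in \<open>w\<close>.\<close>

abbreviation separates_conjugates :: "'a set \<Rightarrow> 'a gword \<Rightarrow> 'a \<Rightarrow> bool" where
  "separates_conjugates N w y \<equiv> (\<forall>j < length w. \<forall>d. 1 \<le> d \<longrightarrow> d \<le> length w \<longrightarrow>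
     N #> (wv (take j w) \<otimes> y [^] (d::nat) \<otimes> inv (wv (take j w)) \<otimes> wv w) \<noteq>
     N #> (wv w \<otimes> (wv (take j w) \<otimes> y [^] d \<otimes> inv (wv (take j w)))))"

text \<open>Otherwise all vertices \<open>g \<otimes> y [^] k\<close> lie on the path of
  \<open>w\<close>. Two of them at the same position in \<open>w\<close> give a prefix conjugate of
  a power of \<open>y\<close> that is a power of \<open>wv w\<close> modulo
  \<open>N\<close>.\<close>

lemma exists_edge_avoiding_loop:
  assumes N: "N \<lhd> G" and w: "root_word w" and y: "y \<in> carrier G" and g: "g \<in> carrier G"
    and sep: "separates_conjugates N w y" and l: "fst l \<in> S"
  shows "\<exists>k. flow (edge_indicator N (g \<otimes> y [^] (k::nat)) l) (wv w [^] (a::nat)) \<one> = 0"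
proof (rule ccontr)
  assume "\<not> ?thesis"
  then have "\<exists>q r. r < length w \<and> N #> (g \<otimes> y [^] k) = N #> (wv w [^] (q::nat) \<otimes> wv (take r w))" for k :: nat
    using loop_edge_vertex[OF N w _ l, of "g \<otimes> y [^] k" a] g y by blast
  then obtain q r where qr: "\<And>k::nat. r k < length w \<and>
      N #> (g \<otimes> y [^] k) = N #> (wv w [^] (q k :: nat) \<otimes> wv (take (r k) w))"
    by metis
  \<comment> \<open>There are \<open>length w + 1\<close> exponents but only \<open>length w\<close>
    positions; this also yields \<open>d \<le> length w\<close>.\<close>
  have "\<not> inj_on r {..length w}"
  proof
    assume "inj_on r {..length w}"
    moreover have "r ` {..length w} \<subseteq> {..<length w}"
      using qr by auto
    ultimately have "card {..length w} \<le> card {..<length w}"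
      by (rule card_inj_on_le) simp
    then show False
      by simp
  qed
  then obtain i j where ij: "i < j" "j \<le> length w" "r i = r j"
    unfolding inj_on_def by (metis atMost_iff linorder_neqE_nat)
  define d u where "d = j - i" and "u = wv (take (r i) w)"
  have x: "wv w \<in> carrier G" and u: "u \<in> carrier G"
    using w root_word_closed prefix_closed[OF root_word_letters[OF w]] unfolding u_def by auto
  have "N #> (wv w [^] q j \<otimes> u) = N #> (g \<otimes> y [^] j)"
    using qr[of j] ij unfolding u_def by simp
  also have "g \<otimes> y [^] j = g \<otimes> y [^] i \<otimes> y [^] d"
    using ij g y by (simp add: d_def m_assoc nat_pow_mult)
  also have "N #> (g \<otimes> y [^] i \<otimes> y [^] d) = N #> (wv w [^] q i \<otimes> u \<otimes> y [^] d)"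
    using qr[of i] coset_mult_right_iff[OF N] g y x u unfolding u_def by simp
  also have "wv w [^] q i \<otimes> u \<otimes> y [^] d = wv w [^] q i \<otimes> (u \<otimes> y [^] d)"
    using x u y by (simp add: m_assoc)
  finally have "N #> (u \<otimes> y [^] d \<otimes> inv u) = N #> (wv w [^] (int (q j) - int (q i)))"
    by (intro coset_solve_pow[OF N x _ u]) (use u y in simp_all)
  then have "N #> (u \<otimes> y [^] d \<otimes> inv u \<otimes> wv w) = N #> (wv w \<otimes> (u \<otimes> y [^] d \<otimes> inv u))"
    by (intro coset_int_pow_commutes[OF N x]) (use u y in simp_all)
  moreover have "1 \<le> d" "d \<le> length w" "r i < length w"
    using ij qr unfolding d_def by auto
  ultimately show False
    using sep unfolding u_def by blast
qed

text \<open>The weight is the indicator of an edge on the loop of \<open>w2\<close> through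
  \<open>g\<close> along which the path of \<open>w1\<close> has zero flow. The loop of
  \<open>w2\<close> is simple and meets the edge exactly once.\<close>

lemma separating_cochain_at:
  assumes N: "N \<lhd> G" and w: "root_word w1" "root_word w2"
    and sep: "separates_conjugates N w1 (wv w2)" "separates_root N w2"
    and b: "period N (wv w2) > 0" and g: "g \<in> carrier G"
  shows "\<exists>f. coset_invariant N f \<and> flow f (wv w1 [^] (a::nat)) \<one> = 0 \<and>
    flow f (wv w2 [^] period N (wv w2)) g \<noteq> 0"
proof -
  define y b where "y = wv w2" and "b = period N y"
  have y: "y \<in> carrier G"
    unfolding y_def using w(2) by (rule root_word_closed)
  have "hd w2 \<in> set w2"
    using root_word_nonempty[OF w(2)] by simp
  then have l: "fst (hd w2) \<in> S"
    using root_word_letters[OF w(2)] by (auto simp: mem_Times_iff)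
  obtain k :: nat where k: "flow (edge_indicator N (g \<otimes> y [^] k) (hd w2)) (wv w1 [^] a) \<one> = 0"
    using exists_edge_avoiding_loop[OF N w(1) y g _ l] sep(1) unfolding y_def by blast
  define f where "f = edge_indicator N (g \<otimes> y [^] k) (hd w2)"
  have inv: "coset_invariant N f"
    unfolding f_def by (rule edge_indicator_invariant)
  have "flow f (y [^] b) (g \<otimes> y [^] k) =
      letter_sign (hd w2) * f (edge_source (g \<otimes> y [^] k) (hd w2)) (fst (hd w2))"
    unfolding y_def b_def
  proof (rule loop_first_edge[OF N w(2) sep(2) b])
    show "g \<otimes> wv w2 [^] k \<in> carrier G"
      using g y unfolding y_def by simp
    show "s = fst (hd w2) \<and> N #> h = N #> edge_source (g \<otimes> wv w2 [^] k) (hd w2)"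
      if "f h s \<noteq> 0" for h s
      using that unfolding f_def y_def edge_indicator_def of_bool_eq_0_iff not_not .
  qed
  then have "flow f (y [^] b) (g \<otimes> y [^] k) \<noteq> 0"
    unfolding f_def edge_indicator_def by simp
  \<comment> \<open>Both flows belong to the same loop with different base points, as
    \<open>y [^] b\<close> and \<open>y [^] k\<close> commute.\<close>
  moreover have "flow f (y [^] b) g = flow f (y [^] b) (g \<otimes> y [^] k)"
  proof -
    have yb: "y [^] b \<in> N"
      using pow_mem_normal_iff[OF N y] by (simp add: b_def)
    have "y [^] b \<otimes> y [^] k = y [^] k \<otimes> y [^] b"
      using y by (simp add: nat_pow_mult add.commute)
    moreover have "flow f (y [^] b \<otimes> y [^] k) g = flow f (y [^] b) g + flow f (y [^] k) g"
      using flow_mult_normal[OF N inv yb _ g] y by simp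
    moreover have "flow f (y [^] k \<otimes> y [^] b) g = flow f (y [^] k) g + flow f (y [^] b) (g \<otimes> y [^] k)"
      using flow_mult y g by simp
    ultimately show ?thesis
      by simp
  qed
  ultimately show ?thesis
    using inv k unfolding f_def y_def b_def by metis
qed

text \<open>Flows depend only on cosets, so finitely many starting vertices suffice; they are
  treated one after another.\<close>

lemma separating_cochain:
  assumes N: "N \<lhd> G" "finite (rcosets N)" and w: "root_word w1" "root_word w2"
    and sep: "separates_conjugates N w1 (wv w2)" "separates_root N w2"
    and b: "period N (wv w2) > 0"
  shows "\<exists>f. coset_invariant N f \<and> flow f (wv w1 [^] (a::nat)) \<one> = 0 \<and>
    (\<forall>g \<in> carrier G. flow f (wv w2 [^] period N (wv w2)) g \<noteq> 0)"
proof -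
  define x z where "x = wv w1 [^] a" and "z = wv w2 [^] period N (wv w2)"
  have z: "z \<in> carrier G"
    unfolding z_def using root_word_closed[OF w(2)] by simp
  obtain R where R: "R \<subseteq> carrier G" "finite R" "\<And>g. g \<in> carrier G \<Longrightarrow> \<exists>r\<in>R. N #> g = N #> r"
    using finite_transversal[OF N] by blast
  have "\<exists>f. coset_invariant N f \<and> flow f x \<one> = 0 \<and> (\<forall>r \<in> R. flow f z r \<noteq> 0)"
    using R(2,1)
  proof (induction R rule: finite_induct)
    case empty
    have "coset_invariant N (\<lambda>h s. 0)" "flow (\<lambda>h s. 0) x \<one> = 0"
      using flow_sum[of "\<lambda>_ _ _. 0" "{}" x \<one>] by (simp_all add: coset_invariant_def)
    then show ?case
      by blast
  next
    case (insert g R)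
    then obtain f where f: "coset_invariant N f" "flow f x \<one> = 0" "\<And>r. r \<in> R \<Longrightarrow> flow f z r \<noteq> 0"
      by auto
    obtain e where e: "coset_invariant N e" "flow e x \<one> = 0" "flow e z g \<noteq> 0"
      using separating_cochain_at[OF N(1) w sep b] insert.prems unfolding x_def z_def by blast
    show ?case
    proof (cases "flow f z g = 0")
      case False
      then show ?thesis
        using f by blast
    next
      case True
      \<comment> \<open>\<open>K\<close> exceeds each flow of \<open>e\<close> at the earlier
        vertices, so adding \<open>e\<close> to \<open>K\<close> times \<open>f\<close> cannot
        cancel the nonzero flows there, while at \<open>g\<close> only \<open>e\<close>
        contributes.\<close>
      define K where "K = 1 + (\<Sum>r\<in>R. \<bar>flow e z r\<bar>)"
      define f' where "f' = (\<lambda>h s. K * f h s + 1 * e h s)"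
      have flow_f': "flow f' y h = K * flow f y h + flow e y h" for y h
        unfolding f'_def flow_linear by simp
      have "flow f' z r \<noteq> 0" if r: "r \<in> R" for r
      proof
        assume "flow f' z r = 0"
        then have "\<bar>K * flow f z r\<bar> = \<bar>flow e z r\<bar>"
          unfolding flow_f' by (simp add: add_eq_0_iff)
        moreover have "\<bar>flow e z r\<bar> < K"
          using member_le_sum[OF r, of "\<lambda>r. \<bar>flow e z r\<bar>"] insert.hyps(1) unfolding K_def by simp
        moreover have "\<bar>K\<bar> * 1 \<le> \<bar>K\<bar> * \<bar>flow f z r\<bar>"
          using f(3)[OF r] by (intro mult_left_mono) auto
        ultimately show False
          by (simp add: abs_mult)
      qed
      moreover have "flow f' z g \<noteq> 0" "flow f' x \<one> = 0"
        using True e f by (simp_all add: flow_f')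
      moreover have "coset_invariant N f'"
        unfolding f'_def using f e by (intro coset_invariant_linear)
      ultimately show ?thesis
        by blast
    qed
  qed
  then obtain f where f: "coset_invariant N f" "flow f x \<one> = 0" "\<And>r. r \<in> R \<Longrightarrow> flow f z r \<noteq> 0"
    by blast
  have "flow f z g \<noteq> 0" if "g \<in> carrier G" for g
    using R(3)[OF that] f(3) flow_coset_invariant[OF N(1) f(1) z that] R(1) by (metis subsetD)
  then show ?thesis
    using f unfolding x_def z_def by blast
qed

lemma flow_pow:
  assumes x: "x \<in> carrier G" and g: "g \<in> carrier G"
  shows "flow f (x [^] (n::nat)) g = (\<Sum>i<n. flow f x (g \<otimes> x [^] i))"
proof (induction n)
  case (Suc n)
  then show ?case
    using flow_mult[OF _ x g, of "x [^] n"] x by simp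
qed (simp add: flow_one g)

end

section \<open>Making the order of one root word large while that of another stays bounded\<close>

context based_free_group_prime
begin

lemma tower_pow_mem: "tower N \<Longrightarrow> x \<in> carrier G \<Longrightarrow> \<exists>k. x [^] (p ^ k) \<in> N"
proof (induction rule: tower.induct)
  case top
  then show ?case by auto
next
  case (step M N)
  then obtain k where "x [^] (p ^ k) \<in> M"
    by blast
  then have "(x [^] (p ^ k)) [^] p \<in> N"
    using step.hyps by blast
  then have "x [^] (p ^ Suc k) \<in> N"
    using step.prems by (simp add: nat_pow_pow mult.commute)
  then show ?case
    by blast
qed

lemma tower_period: "tower N \<Longrightarrow> x \<in> carrier G \<Longrightarrow> \<exists>k. period N x = p ^ k"
  using tower_pow_mem[of N x] pow_mem_normal_iff[OF tower_normal] divides_primepow_nat[OF prime] by metis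

lemma tower_period_pos: "tower N \<Longrightarrow> x \<in> carrier G \<Longrightarrow> period N x > 0"
  using tower_period[of N x] prime prime_gt_0_nat by auto

lemma tower_separates:
  assumes "finite X" and "X \<subseteq> carrier G \<times> carrier G" and "\<And>a b. (a, b) \<in> X \<Longrightarrow> a \<noteq> b"
  shows "\<exists>N. tower N \<and> (\<forall>(a, b) \<in> X. N #> a \<noteq> N #> b)"
proof -
  have "\<exists>N. tower N \<and> (\<lambda>(a, b). a \<otimes> inv b) ` X \<inter> N = {}"
  proof (rule tower_avoids_finite)
    fix z assume "z \<in> (\<lambda>(a, b). a \<otimes> inv b) ` X"
    then obtain a b where ab: "(a, b) \<in> X" "z = a \<otimes> inv b"
      by auto
    then have closed: "a \<in> carrier G" "b \<in> carrier G"
      using assms(2) by auto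
    then have "z \<noteq> \<one>"
      using assms(3)[OF ab(1)] ab(2) inv_solve_right'[of \<one> a b] by auto
    then show "\<exists>N. tower N \<and> z \<notin> N"
      using closed ab by (intro tower_avoids) auto
  qed (use assms in simp)
  then obtain N where N: "tower N" "(\<lambda>(a, b). a \<otimes> inv b) ` X \<inter> N = {}"
    by blast
  have "N #> a \<noteq> N #> b" if "(a, b) \<in> X" for a b
    using that N assms(2) coset_eq_iff[OF tower_normal[OF N(1)], of a b] by fastforce
  then show ?thesis
    using N(1) by blast
qed

text \<open>Finitely many inequalities that hold in \<open>G\<close> survive in some
  \<open>p\<close>-quotient. They hold in \<open>G\<close> by the description of centralizers: if a
  conjugate of \<open>y [^] d\<close> commuted with \<open>x\<close>, a conjugate of
  \<open>x\<close> would be a power of \<open>y\<close>, against \<open>nonconj\<close>.\<close>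

lemma tower_separates_roots:
  assumes w: "root_word w1" "root_word w2"
    and nonconj: "\<And>h i. h \<in> carrier G \<Longrightarrow> inv h \<otimes> wv w1 \<otimes> h \<noteq> wv w2 [^] (i::int)"
  shows "\<exists>N. tower N \<and> separates_root N w1 \<and> separates_root N w2 \<and> separates_conjugates N w1 (wv w2)"
proof -
  define x y where "x = wv w1" and "y = wv w2"
  have xy: "x \<in> carrier G" "y \<in> carrier G"
    unfolding x_def y_def using w root_word_closed by auto
  note pre = w[THEN root_word_letters, THEN prefix_closed]
  define q where "q w = (\<lambda>(i, j). wv (take i w) \<otimes> inv (wv (take j w)))" for w
  define I where "I w = {(i, j). i < length w \<and> j < length w \<and> i \<noteq> j}" for w :: "'a gword"
  define c where "c = (\<lambda>(j, d::nat). wv (take j w1) \<otimes> y [^] d \<otimes> inv (wv (take j w1)))"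
  define J where "J = {(j, d). j < length w1 \<and> 1 \<le> d \<and> d \<le> length w1}"
  define X where "X = (\<lambda>ij. (q w1 ij \<otimes> x, x \<otimes> q w1 ij)) ` I w1 \<union>
    (\<lambda>ij. (q w2 ij \<otimes> y, y \<otimes> q w2 ij)) ` I w2 \<union> (\<lambda>jd. (c jd \<otimes> x, x \<otimes> c jd)) ` J"
  have "finite (I w)" for w
    by (rule finite_subset[of _ "{..<length w} \<times> {..<length w}"]) (auto simp: I_def)
  moreover have "finite J"
    by (rule finite_subset[of _ "{..<length w1} \<times> {..length w1}"]) (auto simp: J_def)
  ultimately have fin: "finite X"
    unfolding X_def by simp
  have q_closed: "q w1 ij \<in> carrier G" "q w2 ij \<in> carrier G" "c ij \<in> carrier G" for ij
    using pre xy unfolding q_def c_def by (auto split: prod.split)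
  then have closed: "X \<subseteq> carrier G \<times> carrier G"
    unfolding X_def using xy by auto
  have q1: "q w1 ij \<otimes> x \<noteq> x \<otimes> q w1 ij" if "ij \<in> I w1" for ij
    using that prefix_quotient_not_central[OF w(1)] unfolding q_def I_def x_def by auto
  have q2: "q w2 ij \<otimes> y \<noteq> y \<otimes> q w2 ij" if "ij \<in> I w2" for ij
    using that prefix_quotient_not_central[OF w(2)] unfolding q_def I_def y_def by auto
  have q3: "c jd \<otimes> x \<noteq> x \<otimes> c jd" if jd: "jd \<in> J" for jd
  proof
    obtain j d where jd': "jd = (j, d)" "1 \<le> d"
      using jd unfolding J_def by auto
    define h v where "h = wv (take j w1)" and "v = inv h \<otimes> x \<otimes> h"
    have h: "h \<in> carrier G"
      unfolding h_def by (rule pre)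
    assume "c jd \<otimes> x = x \<otimes> c jd"
    then have eq: "h \<otimes> y [^] d \<otimes> inv h \<otimes> x = x \<otimes> (h \<otimes> y [^] d \<otimes> inv h)"
      unfolding c_def jd' h_def by simp
    have "v \<otimes> y [^] d = inv h \<otimes> (x \<otimes> (h \<otimes> y [^] d \<otimes> inv h)) \<otimes> h"
      unfolding v_def using h xy by (simp add: m_assoc)
    also have "\<dots> = (inv h \<otimes> h) \<otimes> y [^] d \<otimes> (inv h \<otimes> x \<otimes> h)"
      unfolding eq[symmetric] using h xy by (simp only: m_assoc inv_closed m_closed nat_pow_closed)
    also have "\<dots> = y [^] d \<otimes> v"
      unfolding v_def using h xy by simp
    finally obtain i :: int where "v = y [^] i"
      using centralizer_root_power[OF w(2) jd'(2), of v] h xy unfolding v_def y_def by auto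
    then show False
      using nonconj[OF h] unfolding v_def x_def y_def by blast
  qed
  have "a \<noteq> b" if "(a, b) \<in> X" for a b
    using that q1 q2 q3 unfolding X_def by auto
  from tower_separates[OF fin closed this]
  obtain N where N: "tower N" "\<And>a b. (a, b) \<in> X \<Longrightarrow> N #> a \<noteq> N #> b"
    by blast
  have "separates_root N w1"
  proof (intro allI impI)
    fix i j assume "i < length w1" "j < length w1" "i \<noteq> j"
    then have "(q w1 (i, j) \<otimes> x, x \<otimes> q w1 (i, j)) \<in> X"
      unfolding X_def I_def by blast
    from N(2)[OF this] show "N #> (wv (take i w1) \<otimes> inv (wv (take j w1)) \<otimes> wv w1) \<noteq>
        N #> (wv w1 \<otimes> (wv (take i w1) \<otimes> inv (wv (take j w1))))"
      unfolding q_def x_def by simp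
  qed
  moreover have "separates_root N w2"
  proof (intro allI impI)
    fix i j assume "i < length w2" "j < length w2" "i \<noteq> j"
    then have "(q w2 (i, j) \<otimes> y, y \<otimes> q w2 (i, j)) \<in> X"
      unfolding X_def I_def by blast
    from N(2)[OF this] show "N #> (wv (take i w2) \<otimes> inv (wv (take j w2)) \<otimes> wv w2) \<noteq>
        N #> (wv w2 \<otimes> (wv (take i w2) \<otimes> inv (wv (take j w2))))"
      unfolding q_def y_def by simp
  qed
  moreover have "separates_conjugates N w1 y"
  proof (intro allI impI)
    fix j and d :: nat assume "j < length w1" "1 \<le> d" "d \<le> length w1"
    then have "(c (j, d) \<otimes> x, x \<otimes> c (j, d)) \<in> X"
      unfolding X_def J_def by blast
    from N(2)[OF this] show "N #> (wv (take j w1) \<otimes> y [^] d \<otimes> inv (wv (take j w1)) \<otimes> wv w1) \<noteq>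
        N #> (wv w1 \<otimes> (wv (take j w1) \<otimes> y [^] d \<otimes> inv (wv (take j w1))))"
      unfolding c_def x_def by simp
  qed
  ultimately show ?thesis
    using N(1) unfolding y_def by blast
qed

text \<open>The exponent \<open>J\<close> is fixed by \<open>N\<close> and the first weight
  \<open>f\<close>; \<open>L\<close> enters only afterwards, as the modulus of the last flow
  kernel.\<close>

lemma tower_distorts_root_words:
  assumes w: "root_word w1" "root_word w2"
    and nonconj: "\<And>h i. h \<in> carrier G \<Longrightarrow> inv h \<otimes> wv w1 \<otimes> h \<noteq> wv w2 [^] (i::int)"
  shows "\<exists>J. \<forall>L. \<exists>N. tower N \<and> wv w2 [^] (p ^ J) \<in> N \<and>
    (\<forall>j::nat. wv w1 [^] j \<in> N \<longrightarrow> p ^ L dvd j)"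
proof -
  obtain N where N: "tower N" "separates_root N w1" "separates_root N w2"
    "separates_conjugates N w1 (wv w2)"
    using tower_separates_roots[OF w nonconj] by blast
  have normal: "N \<lhd> G"
    using N(1) by (rule tower_normal)
  define x y where "x = wv w1" and "y = wv w2"
  have x: "x \<in> carrier G" and y: "y \<in> carrier G"
    unfolding x_def y_def using w root_word_closed by auto
  define a b where "a = period N x" and "b = period N y"
  have a_pos: "a > 0" and b_pos: "b > 0"
    unfolding a_def b_def using tower_period_pos[OF N(1)] x y by auto
  obtain B where B: "b = p ^ B"
    using tower_period[OF N(1) y] unfolding b_def by blast
  define X Y where "X = x [^] a" and "Y = y [^] b"
  have XY: "X \<in> N" "Y \<in> N" "X \<in> carrier G" "Y \<in> carrier G"
    unfolding X_def Y_def using x y pow_mem_normal_iff[OF normal] by (auto simp: a_def b_def)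
  obtain f where f: "coset_invariant N f" "flow f X \<one> = 0" "\<And>g. g \<in> carrier G \<Longrightarrow> flow f Y g \<noteq> 0"
    using separating_cochain[OF normal tower_finite[OF N(1)] w N(4,3), of a] b_pos
    unfolding X_def Y_def x_def y_def b_def by auto
  obtain R where R: "R \<subseteq> carrier G" "finite R" "\<And>g. g \<in> carrier G \<Longrightarrow> \<exists>r\<in>R. N #> g = N #> r"
    using finite_transversal[OF normal tower_finite[OF N(1)]] by blast
  \<comment> \<open>A bound for the absolute flow of \<open>f\<close> along \<open>Y\<close> from
    every vertex. As these flows are nonzero and \<open>m < q\<close>, the power \<open>q\<close>
    divides none of them.\<close>
  define m where "m = (\<Sum>r\<in>R. nat \<bar>flow f Y r\<bar>)"
  define q where "q = p ^ Suc m"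
  have p1: "p > 1"
    using prime prime_gt_1_nat by blast
  have flow_not_dvd: "\<not> int q dvd flow f Y g" if g: "g \<in> carrier G" for g
  proof
    assume dvd: "int q dvd flow f Y g"
    obtain r where r: "r \<in> R" "N #> g = N #> r"
      using R(3)[OF g] by blast
    have "flow f Y g = flow f Y r"
      using flow_coset_invariant[OF normal f(1) XY(4) g _ r(2)] R(1) r(1) by blast
    then have "nat \<bar>flow f Y g\<bar> \<le> m"
      unfolding m_def using member_le_sum[OF r(1), of "\<lambda>r. nat \<bar>flow f Y r\<bar>"] R(2) by simp
    also have "m < q"
      unfolding q_def using p1 less_exp[of m] power_mono[of 2 p m] power_strict_increasing[of m "Suc m" p]
      by linarith
    finally have "\<bar>flow f Y g\<bar> < int q"
      by simp
    then show False
      using dvd f(3)[OF g] dvd_imp_le_int[of "flow f Y g" "int q"] by simp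
  qed
  define N1 where "N1 = flow_kernel N f q"
  have N1: "tower N1"
    unfolding N1_def q_def by (rule tower_flow_kernel[OF N(1) f(1)])
  define l where "l = hd w1"
  have "l \<in> set w1"
    unfolding l_def using root_word_nonempty[OF w(1)] by simp
  then have l: "fst l \<in> S"
    using root_word_letters[OF w(1)] by (auto simp: mem_Times_iff)
  \<comment> \<open>Calling \<open>flow f h \<one>\<close> the height of \<open>h\<close>, this is
    the height of the source of the first edge of \<open>w1\<close>.\<close>
  define t0 where "t0 = flow f (edge_source \<one> l) \<one>"
  \<comment> \<open>Modulo \<open>q\<close>, \<open>c\<close> is 1 at \<open>t0\<close>, -1 at
    \<open>t0 + p ^ m\<close> and 0 elsewhere. A coset of a nontrivial subgroup contains both
    residues or neither, so \<open>c\<close> sums to 0 over it.\<close>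
  define c :: "int \<Rightarrow> int" where
    "c t = of_bool (int q dvd t - t0) - of_bool (int q dvd t - t0 - int (p ^ m))" for t
  have c_cong: "c t = c t'" if "int q dvd t - t'" for t t'
  proof -
    have "t - t0 = (t' - t0) + (t - t')" "t - t0 - int (p ^ m) = (t' - t0 - int (p ^ m)) + (t - t')"
      by simp_all
    then show ?thesis
      unfolding c_def by (simp only: dvd_add_left_iff[OF that])
  qed
  have c_t0: "c t0 = 1"
  proof -
    have "\<not> q dvd p ^ m"
      unfolding q_def using p1 by (simp add: power_dvd_imp_le dvd_imp_le nat_dvd_not_less)
    then have "\<not> int q dvd - int (p ^ m)"
      by (simp only: dvd_minus_iff int_dvd_int_iff not_False_eq_True)
    then show ?thesis
      unfolding c_def by simp
  qed
  have c_sum: "(\<Sum>i<q. c (int i * C + t)) = 0" if "\<not> int q dvd C" for C t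
    using sum_residue_shift[OF prime that[unfolded q_def], of "t - t0"]
    unfolding c_def sum_subtractf by (simp add: q_def algebra_simps)
  \<comment> \<open>Supported on the edges above the first edge of \<open>w1\<close>, with a
    coefficient given by the height of the source. Elements of \<open>N1\<close> change heights by
    multiples of \<open>q\<close>, so \<open>F\<close> descends to the graph of
    \<open>N1\<close>.\<close>
  define F where "F h s = edge_indicator N \<one> l h s * c (flow f h \<one>)" for h s
  have flow_N: "flow f (n \<otimes> h) \<one> = flow f n \<one> + flow f h \<one>" if "n \<in> N" "h \<in> carrier G" for n h
    using flow_mult_normal[OF normal f(1) that one_closed] .
  have F_inv: "coset_invariant N1 F"
    unfolding coset_invariant_def
  proof (intro ballI impI)
    fix g h s
    assume gh: "g \<in> carrier G" "h \<in> carrier G" "N1 #> g = N1 #> h"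
    define n where "n = g \<otimes> inv h"
    have n: "n \<in> N1"
      using gh coset_eq_iff[OF tower_normal[OF N1]] unfolding n_def by blast
    then have n': "n \<in> N" "int q dvd flow f n \<one>"
      unfolding N1_def flow_kernel_def by auto
    have g: "g = n \<otimes> h"
      unfolding n_def using gh by (simp add: m_assoc)
    have "N #> g = N #> h"
      using coset_eq_iff[OF normal gh(1,2)] n'(1) unfolding n_def by blast
    moreover have "c (flow f g \<one>) = c (flow f h \<one>)"
      using flow_N[OF n'(1) gh(2)] n'(2) by (intro c_cong) (simp add: g)
    ultimately show "F g s = F h s"
      unfolding F_def edge_indicator_def by simp
  qed
  have X_pow: "flow F (X [^] (n::nat)) \<one> = int n * letter_sign l" for n
  proof -
    \<comment> \<open>Each turn starts at \<open>X [^] i\<close>, which has height 0 because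
      \<open>f\<close> has zero flow along \<open>X\<close>. So every turn meets its first edge at
      height \<open>t0\<close>, where \<open>c\<close> is 1.\<close>
    have "flow F X (\<one> \<otimes> X [^] i) = letter_sign l" for i :: nat
    proof -
      define g where "g = X [^] i"
      have gN: "g \<in> N"
        unfolding g_def by (rule subgroup_nat_pow_closed[OF normal_imp_subgroup[OF normal] XY(1)])
      then have g: "g \<in> carrier G"
        by (rule normal_mem_carrier[OF normal])
      have src: "edge_source g l = g \<otimes> edge_source \<one> l" "edge_source \<one> l \<in> carrier G"
        using g l basis_closed by simp_all
      have "N #> g = N #> \<one>"
        using coset_eq_one_iff[OF normal g] gN by blast
      then have src_N: "N #> edge_source g l = N #> edge_source \<one> l"
        unfolding src(1) using coset_mult_right_iff[OF normal g one_closed src(2)] src(2) by simp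
      have "flow F X g = letter_sign l * F (edge_source g l) (fst l)"
        unfolding X_def x_def a_def l_def
      proof (rule loop_first_edge[OF normal w(1) N(2)])
        show "period N (wv w1) > 0"
          using a_pos unfolding a_def x_def .
        show "g \<in> carrier G" by fact
        show "s = fst (hd w1) \<and> N #> h = N #> edge_source g (hd w1)" if "F h s \<noteq> 0" for h s
          using that src_N unfolding F_def edge_indicator_def l_def by auto
      qed
      also have "F (edge_source g l) (fst l) = c (flow f (edge_source g l) \<one>)"
        unfolding F_def edge_indicator_def src_N by simp
      also have "flow f (edge_source g l) \<one> = flow f g \<one> + t0"
        unfolding src(1) t0_def by (rule flow_N[OF gN src(2)])
      also have "flow f g \<one> = 0"
        unfolding g_def using flow_pow_normal[OF normal f(1) XY(1) one_closed] f(2) by simp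
      finally show ?thesis
        using c_t0 g by (simp add: g_def)
    qed
    then show ?thesis
      unfolding flow_pow[OF XY(3) one_closed] by simp
  qed
  have Y_pow: "flow F (Y [^] q) g = 0" if g: "g \<in> carrier G" for g
  proof -
    \<comment> \<open>Since \<open>g \<otimes> Y [^] i = n [^] i \<otimes> g\<close>, the successive
      turns of \<open>Y\<close> are left translates of the first one by powers of \<open>n\<close>,
      each raising heights by \<open>C\<close>.\<close>
    define n where "n = g \<otimes> Y \<otimes> inv g"
    have n: "n \<in> N"
      unfolding n_def using conj_mem_normal_iff[OF normal g] XY by blast
    then have n': "n \<in> carrier G"
      by (rule normal_mem_carrier[OF normal])
    have ni: "n [^] i \<in> N" for i :: nat
      by (rule subgroup_nat_pow_closed[OF normal_imp_subgroup[OF normal] n])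
    define C where "C = flow f n \<one>"
    have "C = flow f Y g"
      unfolding C_def n_def using flow_conj_normal[OF normal f(1) XY(2) g one_closed] g by simp
    then have C: "\<not> int q dvd C"
      using flow_not_dvd[OF g] by simp
    have F_shift: "F (n [^] i \<otimes> h) s = edge_indicator N \<one> l h s * c (int i * C + flow f h \<one>)"
      if h: "h \<in> carrier G" for i :: nat and h s
    proof -
      have "N #> n [^] i = N #> \<one>"
        using coset_eq_one_iff[OF normal] ni n' by simp
      then have "N #> (n [^] i \<otimes> h) = N #> h"
        using coset_mult_right_iff[OF normal _ one_closed h, of "n [^] i"] n' h by simp
      moreover have "flow f (n [^] i \<otimes> h) \<one> = int i * C + flow f h \<one>"
        using flow_N[OF ni h] flow_pow_normal[OF normal f(1) n one_closed] unfolding C_def by simp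
      ultimately show ?thesis
        unfolding F_def edge_indicator_def by simp
    qed
    have "g \<otimes> Y [^] i = n [^] i \<otimes> g" for i :: nat
      unfolding n_def conj_nat_pow[OF g XY(4)] using g XY(4) by (simp add: m_assoc)
    then have "flow F (Y [^] q) g = (\<Sum>i<q. flow F Y (n [^] i \<otimes> g))"
      unfolding flow_pow[OF XY(4) g] by simp
    also have "\<dots> = flow (\<lambda>h s. \<Sum>i<q. F (n [^] i \<otimes> h) s) Y g"
      unfolding flow_sum using n' XY(4) g by (intro sum.cong) (simp_all add: flow_translate)
    \<comment> \<open>Already the sum of the \<open>q\<close> translated weights vanishes on every
      edge, because the heights run through a coset of the nontrivial subgroup generated by
      \<open>C\<close>.\<close>
    also have "\<dots> = flow (\<lambda>h s. 0) Y g"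
    proof (rule flow_cong[OF _ XY(4) g])
      fix h s assume h: "h \<in> carrier G"
      show "(\<Sum>i<q. F (n [^] i \<otimes> h) s) = 0"
        unfolding F_shift[OF h] sum_distrib_left[symmetric] c_sum[OF C] by simp
    qed
    also have "\<dots> = 0"
      using flow_sum[of "\<lambda>_ _ _. 0" "{}" Y g] by simp
    finally show ?thesis .
  qed
  have "\<exists>M. tower M \<and> y [^] (p ^ (B + Suc m)) \<in> M \<and> (\<forall>j::nat. x [^] j \<in> M \<longrightarrow> p ^ L dvd j)" for L
  proof (intro exI[of _ "flow_kernel N1 F (p ^ L)"] conjI allI impI)
    show "tower (flow_kernel N1 F (p ^ L))"
      by (rule tower_flow_kernel[OF N1 F_inv])
    have "Y [^] q = y [^] (p ^ (B + Suc m))"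
      unfolding Y_def nat_pow_pow[OF y] B q_def by (simp only: power_add)
    moreover have "Y [^] q \<in> N1"
      unfolding N1_def flow_kernel_def
      using flow_pow_normal[OF normal f(1) XY(2)]
        subgroup_nat_pow_closed[OF normal_imp_subgroup[OF normal] XY(2)] by simp
    ultimately show "y [^] (p ^ (B + Suc m)) \<in> flow_kernel N1 F (p ^ L)"
      unfolding flow_kernel_def using Y_pow by simp
  next
    fix j :: nat
    assume j: "x [^] j \<in> flow_kernel N1 F (p ^ L)"
    then have "x [^] j \<in> N"
      unfolding flow_kernel_def N1_def by simp
    then obtain n where n: "j = a * n"
      using pow_mem_normal_iff[OF normal x, of j] unfolding a_def by (auto simp: dvd_def)
    then have "x [^] j = X [^] n"
      unfolding X_def using x by (simp add: nat_pow_pow)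
    then have "int (p ^ L) dvd flow F (X [^] n) \<one>"
      using j one_closed unfolding flow_kernel_def by (metis (no_types, lifting) mem_Collect_eq)
    then have "int (p ^ L) dvd int n * letter_sign l"
      unfolding X_pow .
    then have "int (p ^ L) dvd int n"
      by (auto split: if_splits)
    then show "p ^ L dvd j"
      unfolding n by (simp only: int_dvd_int_iff dvd_mult)
  qed
  then show ?thesis
    unfolding x_def y_def by blast
qed

end

section \<open>Conjugate cyclic subgroups in terms of elements\<close>

context group
begin

definition conjugate_into_common_cyclic :: "'a \<Rightarrow> 'a \<Rightarrow> bool" where
  "conjugate_into_common_cyclic u v \<longleftrightarrow> (\<exists>c \<in> carrier G. \<exists>g \<in> carrier G. \<exists>h \<in> carrier G. \<exists>(i::int) (j::int).
     u = g \<otimes> c [^] i \<otimes> inv g \<and> v = h \<otimes> c [^] j \<otimes> inv h)"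

lemma conjugate_into_common_cyclic_sym:
  "conjugate_into_common_cyclic u v \<Longrightarrow> conjugate_into_common_cyclic v u"
  unfolding conjugate_into_common_cyclic_def by blast

lemma conjugate_into_common_cyclic_one:
  assumes "u \<in> carrier G"
  shows "conjugate_into_common_cyclic u \<one>"
proof -
  have "u = \<one> \<otimes> u [^] (1::int) \<otimes> inv \<one>" "\<one> = \<one> \<otimes> u [^] (0::int) \<otimes> inv \<one>"
    using assms by simp_all
  then show ?thesis
    unfolding conjugate_into_common_cyclic_def using assms one_closed by blast
qed

text \<open>The cyclic subgroups generated by the conjugates of \<open>c\<close> by \<open>g\<close>
  and by \<open>h\<close> are carried to each other by conjugation with
  \<open>h \<otimes> inv g\<close>.\<close>

lemma in_conjugate_cyclic_subgroupsI:
  assumes "conjugate_into_common_cyclic u v"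
  shows "in_conjugate_cyclic_subgroups G u v"
proof -
  obtain c g h and i j :: int where closed: "c \<in> carrier G" "g \<in> carrier G" "h \<in> carrier G"
    and uv: "u = g \<otimes> c [^] i \<otimes> inv g" "v = h \<otimes> c [^] j \<otimes> inv h"
    using assms unfolding conjugate_into_common_cyclic_def by blast
  define conj where "conj g = g \<otimes> c \<otimes> inv g" for g
  define C where "C g = generate G {conj g}" for g
  have C: "C k = {k \<otimes> c [^] i \<otimes> inv k | i. i \<in> (UNIV :: int set)}" "subgroup (C k) G"
    "cyclic_subgroup (C k) G" if "k \<in> carrier G" for k
  proof -
    have "conj k \<in> carrier G"
      unfolding conj_def using that closed(1) by simp
    then show "C k = {k \<otimes> c [^] i \<otimes> inv k | i. i \<in> (UNIV :: int set)}"
      unfolding C_def by (simp add: generate_pow) (simp add: conj_def conj_int_pow that closed(1))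
    show "subgroup (C k) G" "cyclic_subgroup (C k) G"
      unfolding C_def cyclic_subgroup_def using \<open>conj k \<in> carrier G\<close>
      by (auto intro: generate_is_subgroup)
  qed
  define a where "a = h \<otimes> inv g"
  have a: "a \<in> carrier G"
    unfolding a_def using closed by simp
  have "a \<otimes> ((g \<otimes> c [^] k \<otimes> inv g) \<otimes> inv a) = h \<otimes> c [^] k \<otimes> inv h" for k :: int
  proof -
    have "a \<otimes> ((g \<otimes> c [^] k \<otimes> inv g) \<otimes> inv a)
        = h \<otimes> (inv g \<otimes> g) \<otimes> c [^] k \<otimes> (inv g \<otimes> g) \<otimes> inv h"
      unfolding a_def using closed
      by (simp only: m_assoc inv_mult_group inv_inv inv_closed m_closed int_pow_closed)
    then show ?thesis
      using closed by simp
  qed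
  then have "C h = a <# (C g #> inv a)"
    unfolding C(1)[OF closed(3)] C(1)[OF closed(2)] l_coset_def r_coset_def by auto
  then have "conjugate_subgroups G (C g) (C h)"
    unfolding conjugate_subgroups_def using C(2) closed a by blast
  moreover have "u \<in> C g" "v \<in> C h"
    using uv C(1) closed by blast+
  ultimately show ?thesis
    unfolding in_conjugate_cyclic_subgroups_def using C(3) closed by blast
qed

end

section \<open>Orders along a chain and the intermediate value argument\<close>

context based_free_group_prime
begin

text \<open>For a tower, the base \<open>p\<close> logarithm of the order of \<open>x\<close> modulo
  \<open>N\<close>.\<close>

definition depth :: "'a set \<Rightarrow> 'a \<Rightarrow> nat" where
  "depth N x = (LEAST k. x [^] (p ^ k) \<in> N)"

lemma period_eq_depth:
  assumes N: "tower N" and x: "x \<in> carrier G"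
  shows "period N x = p ^ depth N x"
proof -
  obtain k where k: "period N x = p ^ k"
    using tower_period[OF N x] by blast
  have "x [^] (p ^ i) \<in> N \<longleftrightarrow> k \<le> i" for i
    unfolding pow_mem_normal_iff[OF tower_normal[OF N] x] k
    by (rule dvd_power_iff_le[OF prime_ge_2_nat[OF prime]])
  then have "depth N x = k"
    unfolding depth_def by (intro Least_equality) auto
  then show ?thesis
    using k by simp
qed

lemma pow_mem_tower_iff:
  assumes N: "tower N" and x: "x \<in> carrier G"
  shows "x [^] (p ^ k) \<in> N \<longleftrightarrow> depth N x \<le> k"
proof
  assume "x [^] (p ^ k) \<in> N"
  then show "depth N x \<le> k"
    unfolding depth_def by (rule Least_le)
next
  assume "depth N x \<le> k"
  then show "x [^] (p ^ k) \<in> N"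
    unfolding pow_mem_normal_iff[OF tower_normal[OF N] x] period_eq_depth[OF N x]
    by (rule le_imp_power_dvd)
qed

text \<open>This transfers the result for root words to the conjugates of their powers. If
  \<open>x\<close> were conjugate to a power of \<open>y\<close>, both \<open>u1\<close> and
  \<open>u2\<close> would be conjugate to powers of \<open>y\<close>.\<close>

lemma tower_distorts:
  assumes u: "u1 \<in> carrier G" "u2 \<in> carrier G" "u1 \<noteq> \<one>" "u2 \<noteq> \<one>"
    and nonconj: "\<not> conjugate_into_common_cyclic u1 u2"
  shows "\<exists>J. \<forall>L. \<exists>N. tower N \<and> depth N u2 \<le> J \<and> L \<le> depth N u1"
proof -
  obtain w1 h1 k1 where w1: "root_word w1" "h1 \<in> carrier G" "k1 \<ge> (1::nat)"
    "u1 = h1 \<otimes> wv w1 [^] k1 \<otimes> inv h1"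
    using root_exists[OF u(1,3)] by blast
  obtain w2 h2 k2 where w2: "root_word w2" "h2 \<in> carrier G" "k2 \<ge> (1::nat)"
    "u2 = h2 \<otimes> wv w2 [^] k2 \<otimes> inv h2"
    using root_exists[OF u(2,4)] by blast
  define x y where "x = wv w1" and "y = wv w2"
  have xy: "x \<in> carrier G" "y \<in> carrier G"
    unfolding x_def y_def using w1(1) w2(1) root_word_closed by auto
  have "inv h \<otimes> x \<otimes> h \<noteq> y [^] i" if h: "h \<in> carrier G" for h and i :: int
  proof
    assume eq: "inv h \<otimes> x \<otimes> h = y [^] i"
    have "x = h \<otimes> y [^] i \<otimes> inv h"
      using h xy unfolding eq[symmetric]
      by (metis inv_closed inv_inv inv_solve_left' inv_solve_right' m_assoc m_closed)
    then have "x [^] k1 = h \<otimes> (y [^] i) [^] k1 \<otimes> inv h"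
      using conj_nat_pow[OF h, of "y [^] i" k1] xy by simp
    also have "(y [^] i) [^] k1 = y [^] (i * int k1)"
      using xy by (simp add: int_pow_pow flip: int_pow_int)
    finally have "u1 = (h1 \<otimes> h) \<otimes> y [^] (i * int k1) \<otimes> inv (h1 \<otimes> h)"
      unfolding w1(4) x_def[symmetric] using h w1(2) xy by (simp add: inv_mult_group m_assoc)
    moreover have "u2 = h2 \<otimes> y [^] int k2 \<otimes> inv h2"
      unfolding w2(4) y_def[symmetric] by (simp add: int_pow_int)
    ultimately show False
      using nonconj xy h w1(2) w2(2) unfolding conjugate_into_common_cyclic_def by (metis m_closed)
  qed
  then obtain J where J: "\<And>L. \<exists>N. tower N \<and> y [^] (p ^ J) \<in> N \<and>
      (\<forall>j::nat. x [^] j \<in> N \<longrightarrow> p ^ L dvd j)"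
    using tower_distorts_root_words[OF w1(1) w2(1)] unfolding x_def y_def by blast
  have "\<exists>N. tower N \<and> depth N u2 \<le> J \<and> L \<le> depth N u1" for L
  proof -
    \<comment> \<open>The surplus \<open>k1\<close> compensates for passing from \<open>x\<close> to
      its power \<open>x [^] k1\<close>, which costs less than a factor \<open>p ^ k1\<close> in the
      order.\<close>
    obtain N where N: "tower N" "y [^] (p ^ J) \<in> N"
      "\<And>j::nat. x [^] j \<in> N \<Longrightarrow> p ^ (L + k1) dvd j"
      using J[of "L + k1"] by blast
    note normal = tower_normal[OF N(1)]
    have "(y [^] (p ^ J)) [^] k2 \<in> N"
      by (rule subgroup_nat_pow_closed[OF normal_imp_subgroup[OF normal] N(2)])
    then have "(y [^] k2) [^] (p ^ J) \<in> N"
      using xy by (simp add: nat_pow_pow mult.commute)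
    then have "u2 [^] (p ^ J) \<in> N"
      unfolding w2(4) y_def[symmetric] using xy w2(2)
      by (simp add: conj_nat_pow conj_mem_normal_iff[OF normal])
    then have "depth N u2 \<le> J"
      using pow_mem_tower_iff[OF N(1) u(2)] by simp
    moreover have "L \<le> depth N u1"
    proof -
      define d where "d = depth N u1"
      have "u1 [^] (p ^ d) \<in> N"
        using pow_mem_tower_iff[OF N(1) u(1)] by (simp add: d_def)
      then have "(x [^] k1) [^] (p ^ d) \<in> N"
        unfolding w1(4) x_def[symmetric] using xy w1(2)
        by (simp add: conj_nat_pow conj_mem_normal_iff[OF normal])
      then have "p ^ (L + k1) dvd k1 * p ^ d"
        using N(3) xy by (simp add: nat_pow_pow)
      then have "p ^ (L + k1) \<le> k1 * p ^ d"
        using w1(3) prime prime_gt_0_nat by (intro dvd_imp_le) auto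
      also have "k1 < p ^ k1"
        using less_exp[of k1] power_mono[of 2 p k1] prime_ge_2_nat[OF prime] by linarith
      then have "k1 * p ^ d < p ^ k1 * p ^ d"
        using prime prime_gt_0_nat by simp
      finally have "p ^ (L + k1) < p ^ (d + k1)"
        by (simp add: power_add mult.commute)
      then show ?thesis
        using prime_gt_1_nat[OF prime] unfolding d_def[symmetric] by simp
    qed
    ultimately show ?thesis
      using N(1) by blast
  qed
  then show ?thesis
    by blast
qed

text \<open>For a tower, the exponent of \<open>p\<close> in the ratio of the two orders modulo
  \<open>N\<close>.\<close>

definition depth_gap :: "'a \<Rightarrow> 'a \<Rightarrow> 'a set \<Rightarrow> int" where
  "depth_gap u1 u2 N = int (depth N u1) - int (depth N u2)"

text \<open>Along the chain of \<open>N\<close> intersected with \<open>M\<close>, each depth grows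
  by 0 or 1 at a step, so their difference moves by at most 1 and skips no integer.\<close>

lemma depth_gap_intermediate_value:
  assumes M: "tower M" and N: "tower N" and u: "u1 \<in> carrier G" "u2 \<in> carrier G"
    and between: "min (depth_gap u1 u2 M) (depth_gap u1 u2 (M \<inter> N)) \<le> n"
      "n \<le> max (depth_gap u1 u2 M) (depth_gap u1 u2 (M \<inter> N))"
  shows "\<exists>K. tower K \<and> K \<subseteq> M \<and> depth_gap u1 u2 K = n"
  using N between
proof (induction rule: tower.induct)
  case top
  have "M \<inter> carrier G = M"
    using normal_mem_carrier[OF tower_normal[OF M]] by blast
  then show ?case
    using top M by (intro exI[of _ M]) auto
next
  case (step N N')
  have towers: "tower (M \<inter> N)" "tower (M \<inter> N')"
    using M step.hyps tower_Int tower.step by blast+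
  have depth_step: "depth (M \<inter> N) x \<le> depth (M \<inter> N') x \<and> depth (M \<inter> N') x \<le> Suc (depth (M \<inter> N) x)"
    if x: "x \<in> carrier G" for x
  proof -
    have "x [^] (p ^ depth (M \<inter> N') x) \<in> M \<inter> N"
      using pow_mem_tower_iff[OF towers(2) x] step.hyps by blast
    moreover have "x [^] (p ^ depth (M \<inter> N) x) \<in> M \<inter> N"
      using pow_mem_tower_iff[OF towers(1) x] by blast
    then have "(x [^] (p ^ depth (M \<inter> N) x)) [^] p \<in> M \<inter> N'"
      using step.hyps subgroup_nat_pow_closed[OF normal_imp_subgroup[OF tower_normal[OF M]]] by blast
    then have "x [^] (p ^ Suc (depth (M \<inter> N) x)) \<in> M \<inter> N'"
      using x by (simp add: nat_pow_pow mult.commute)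
    ultimately show ?thesis
      using pow_mem_tower_iff[OF towers(1) x] pow_mem_tower_iff[OF towers(2) x] by blast
  qed
  show ?case
  proof (cases "depth_gap u1 u2 (M \<inter> N') = n")
    case True
    then show ?thesis
      using towers(2) by blast
  next
    case False
    have "\<bar>depth_gap u1 u2 (M \<inter> N') - depth_gap u1 u2 (M \<inter> N)\<bar> \<le> 1"
      using depth_step[OF u(1)] depth_step[OF u(2)] unfolding depth_gap_def by linarith
    then have "min (depth_gap u1 u2 M) (depth_gap u1 u2 (M \<inter> N)) \<le> n"
      "n \<le> max (depth_gap u1 u2 M) (depth_gap u1 u2 (M \<inter> N))"
      using step.prems False by linarith+
    then show ?thesis
      by (rule step.IH)
  qed
qed

lemma depth_gap_exceeds:
  assumes M: "tower M" and u: "u1 \<in> carrier G" "u2 \<in> carrier G"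
    and distorts: "\<exists>J. \<forall>L. \<exists>N. tower N \<and> depth N u2 \<le> J \<and> L \<le> depth N u1"
  shows "\<exists>N. tower N \<and> n \<le> depth_gap u1 u2 (M \<inter> N)"
proof -
  obtain J where J: "\<And>L. \<exists>N. tower N \<and> depth N u2 \<le> J \<and> L \<le> depth N u1"
    using distorts by blast
  \<comment> \<open>\<open>u2 [^] (p ^ B)\<close> lies in both \<open>M\<close> and
    \<open>N\<close>, so \<open>B\<close> bounds the depth of \<open>u2\<close> in the intersection
    before \<open>N\<close> is chosen to make that of \<open>u1\<close> large.\<close>
  define B where "B = max J (depth M u2)"
  obtain N where N: "tower N" "depth N u2 \<le> J" "B + nat n \<le> depth N u1"
    using J by blast
  have MN: "tower (M \<inter> N)"
    using N(1) M by (rule tower_Int)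
  have "u2 [^] (p ^ B) \<in> M \<inter> N"
    using N(2) pow_mem_tower_iff[OF N(1) u(2)] pow_mem_tower_iff[OF M u(2)] unfolding B_def by simp
  then have "depth (M \<inter> N) u2 \<le> B"
    using pow_mem_tower_iff[OF MN u(2)] by simp
  moreover have "u1 [^] (p ^ depth (M \<inter> N) u1) \<in> N"
    using pow_mem_tower_iff[OF MN u(1)] by blast
  then have "depth N u1 \<le> depth (M \<inter> N) u1"
    using pow_mem_tower_iff[OF N(1) u(1)] by simp
  ultimately have "n \<le> depth_gap u1 u2 (M \<inter> N)"
    using N(3) unfolding depth_gap_def by linarith
  then show ?thesis
    using N(1) by blast
qed

text \<open>Distortion in both directions brings the gap above and below \<open>n\<close> inside any
  given tower; the intermediate value argument supplies \<open>n\<close> itself.\<close>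

lemma depth_gap_surjective:
  assumes u: "u1 \<in> carrier G" "u2 \<in> carrier G" "u1 \<noteq> \<one>" "u2 \<noteq> \<one>"
    and nonconj: "\<not> conjugate_into_common_cyclic u1 u2"
  shows "\<exists>N. tower N \<and> u1 \<notin> N \<and> u2 \<notin> N \<and> depth_gap u1 u2 N = n"
proof -
  \<comment> \<open>Starting below an \<open>M\<close> that avoids both elements ensures that they
    stay nontrivial in every later quotient.\<close>
  obtain M where M: "tower M" "{u1, u2} \<inter> M = {}"
    using tower_avoids_finite[of "{u1, u2}"] tower_avoids u by auto
  have nonconj': "\<not> conjugate_into_common_cyclic u2 u1"
    using nonconj conjugate_into_common_cyclic_sym by blast
  obtain N' where N': "tower N'" "- n \<le> depth_gap u2 u1 (M \<inter> N')"
    using depth_gap_exceeds[OF M(1) u(2,1) tower_distorts[OF u(2,1,4,3) nonconj'], of "- n"] by blast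
  obtain N where N: "tower N" "n \<le> depth_gap u1 u2 (M \<inter> N)"
    using depth_gap_exceeds[OF M(1) u(1,2) tower_distorts[OF u nonconj], of n] by blast
  have "\<exists>K. tower K \<and> K \<subseteq> M \<and> depth_gap u1 u2 K = n"
  proof (cases "depth_gap u1 u2 M \<le> n")
    case True
    then show ?thesis
      using N by (intro depth_gap_intermediate_value[OF M(1) N(1) u(1,2)]) auto
  next
    case False
    then show ?thesis
      using N' by (intro depth_gap_intermediate_value[OF M(1) N'(1) u(1,2)]) (auto simp: depth_gap_def)
  qed
  then show ?thesis
    using M(2) by blast
qed

text \<open>The finitely many cosets of \<open>N\<close> are numbered injectively, and the group
  structure of the quotient is transported to these numbers.\<close>

lemma tower_quotient:
  assumes N: "tower N"
  shows "\<exists>(P :: nat monoid) \<phi>. finite_p_group p P \<and> \<phi> \<in> epi G P \<and>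
    (\<forall>x \<in> carrier G. (\<phi> x = \<one>\<^bsub>P\<^esub> \<longleftrightarrow> x \<in> N) \<and> group.ord P (\<phi> x) = p ^ depth N x)"
proof -
  note normal = tower_normal[OF N]
  obtain enc :: "'a set \<Rightarrow> nat" where enc: "inj_on enc (rcosets N)"
    using finite_imp_inj_to_nat_seg[OF tower_finite[OF N]] by blast
  define \<phi> where "\<phi> x = enc (N #> x)" for x
  define P where "P = image_group \<phi> G"
  have \<phi>_eq: "\<phi> x = \<phi> y \<longleftrightarrow> N #> x = N #> y" if "x \<in> carrier G" "y \<in> carrier G" for x y
    unfolding \<phi>_def using that by (intro inj_on_eq_iff[OF enc]) (auto intro: coset_in_rcosets[OF normal])
  have weak: "weak_group_morphism \<phi> N G"
    using normal by (rule weak_group_morphismsI) (simp add: \<phi>_eq coset_eq_iff[OF normal])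
  have hom: "\<phi> \<in> hom G P"
    unfolding P_def by (rule weak_group_morphism_is_hom[OF weak])
  interpret P: group P
    unfolding P_def by (rule image_group_is_group[OF weak])
  interpret \<phi>: group_hom G P \<phi>
    using hom by unfold_locales
  have carrier: "carrier P = \<phi> ` carrier G"
    unfolding P_def by (rule image_group_carrier)
  have ker: "\<phi> x = \<one>\<^bsub>P\<^esub> \<longleftrightarrow> x \<in> N" if "x \<in> carrier G" for x
    using \<phi>_eq[OF that one_closed] coset_eq_one_iff[OF normal that]
    unfolding P_def image_group_one by simp
  have pow: "\<phi> x [^]\<^bsub>P\<^esub> n = \<one>\<^bsub>P\<^esub> \<longleftrightarrow> p ^ depth N x dvd n" if x: "x \<in> carrier G" for x and n :: nat
    using ker[of "x [^] n"] pow_mem_normal_iff[OF normal x] period_eq_depth[OF N x] x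
    by (simp add: \<phi>.hom_nat_pow)
  have fin: "finite (carrier P)"
  proof -
    have "carrier P \<subseteq> enc ` (rcosets N)"
      unfolding carrier \<phi>_def using coset_in_rcosets[OF normal] by blast
    then show ?thesis
      using tower_finite[OF N] finite_subset by blast
  qed
  have "\<exists>k. z [^]\<^bsub>P\<^esub> (p ^ k) = \<one>\<^bsub>P\<^esub>" if z: "z \<in> carrier P" for z
  proof -
    obtain x where x: "x \<in> carrier G" "z = \<phi> x"
      using z unfolding carrier by blast
    have "z [^]\<^bsub>P\<^esub> (p ^ depth N x) = \<one>\<^bsub>P\<^esub>"
      using pow[OF x(1), of "p ^ depth N x"] x(2) by simp
    then show ?thesis ..
  qed
  then have "\<exists>k. order P = p ^ k"
    by (rule P.order_prime_power[OF prime fin])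
  then have "finite_p_group p P"
    unfolding finite_p_group_def using fin P.is_group by blast
  moreover have "\<phi> \<in> epi G P"
    unfolding epi_def using hom carrier by blast
  moreover have "P.ord (\<phi> x) = p ^ depth N x" if x: "x \<in> carrier G" for x
    using P.ord_unique[of "\<phi> x" "p ^ depth N x"] pow[OF x] x by simp
  ultimately show ?thesis
    using ker by blast
qed

end

(* Every finite group is isomorphic to one whose elements are natural numbers, so
   taking P :: nat monoid does not restrict which finite p-groups occur. *)
theorem mainTheorem1:
  fixes F :: "('a, 'b) monoid_scheme" and u1 u2 :: 'a and p :: nat and n :: int
  assumes "free_group F"
    and "u1 \<in> carrier F" and "u2 \<in> carrier F"
    and "\<not> in_conjugate_cyclic_subgroups F u1 u2"
    and "prime p"
  shows "\<exists>(P :: nat monoid) \<phi>. finite_p_group p P \<and> \<phi> \<in> epi F P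
           \<and> \<phi> u1 \<noteq> \<one>\<^bsub>P\<^esub> \<and> \<phi> u2 \<noteq> \<one>\<^bsub>P\<^esub>
           \<and> real (group.ord P (\<phi> u1)) / real (group.ord P (\<phi> u2)) = real p powi n"
proof -
  obtain S where F: "group F" and S: "free_basis F S"
    using assms(1) unfolding free_group_def by blast
  interpret group F by (rule F)
  interpret based_free_group_prime F S p
    using S assms(5) by unfold_locales
  have "\<not> conjugate_into_common_cyclic u1 u2"
    using assms(4) in_conjugate_cyclic_subgroupsI by blast
  \<comment> \<open>The identity lies in every cyclic subgroup, so a trivial \<open>u1\<close> or
    \<open>u2\<close> would contradict the hypothesis.\<close>
  moreover from this have "u1 \<noteq> \<one>\<^bsub>F\<^esub>" "u2 \<noteq> \<one>\<^bsub>F\<^esub>"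
    using assms(2,3) conjugate_into_common_cyclic_one conjugate_into_common_cyclic_sym by blast+
  ultimately obtain N where N: "tower N" "u1 \<notin> N" "u2 \<notin> N" "depth_gap u1 u2 N = n"
    using depth_gap_surjective assms(2,3) by blast
  obtain P :: "nat monoid" and \<phi> where P: "finite_p_group p P" "\<phi> \<in> epi F P"
    and \<phi>: "\<And>x. x \<in> carrier F \<Longrightarrow> (\<phi> x = \<one>\<^bsub>P\<^esub> \<longleftrightarrow> x \<in> N) \<and> group.ord P (\<phi> x) = p ^ depth N x"
    using tower_quotient[OF N(1)] by blast
  have "real p \<noteq> 0"
    using assms(5) by auto
  then have "real p powi n = real p ^ depth N u1 / real p ^ depth N u2"
    using N(4) power_int_diff[of "real p" "int (depth N u1)" "int (depth N u2)"]
    unfolding depth_gap_def by simp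
  then show ?thesis
    using P \<phi> assms(2,3) N(2,3) by (intro exI[of _ P] exI[of _ \<phi>]) simp
qed

end
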